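(* For any prime power $q$ there is a constant $c_q>1$ such that every strong blocking set in $\mathrm{PG}(k-1,q)$ has size at least $(c_q-o(1))(q+1)(k-1)$, where $o(1)\to 0$ as $k\to\infty$. Moreover $c_q$ can be taken to be the unique solution $x\ge 1$ of \[M_q\!\left(\frac{q-1}{x(q+1)}\right)=\frac{1}{x(q+1)}.\]
   Context: $\mathrm{PG}(k-1,q)$ is the projective space whose points, ..., hyperplanes are the $1$-, ..., $(k-1)$-dimensional vector subspaces of $\mathbb{F}_q^k$. A strong blocking set is a set $S$ of points such that for every hyperplane $H$, $S\cap H$ spans $H$. The $q$-ary entropy is $H_q(x)=x\log_q(q-1)-x\log_q x-(1-x)\log_q(1-x)$, and $M_q(\delta)=H_q\!\left(\frac1q\left(q-1-(q-2)\delta-2\sqrt{(q-1)\delta(1-\delta)}\right)\right)$ (the function in the MRRW bound). *)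

theory Defs
  imports Complex_Main "HOL-Library.Function_Algebras"
begin

text \<open>Vectors of F_q^k are represented as functions nat => 'a vanishing outside {0..<k};
  the ambient vector space nat => 'a carries the pointwise scalar multiplication.\<close>

definition scl :: "'a::field \<Rightarrow> (nat \<Rightarrow> 'a) \<Rightarrow> (nat \<Rightarrow> 'a)" where
  "scl c v = (\<lambda>i. c * v i)"

definition Fvecs :: "nat \<Rightarrow> (nat \<Rightarrow> 'a::field) set" where
  "Fvecs k = {v. \<forall>i\<ge>k. v i = 0}"

definition subspaces_dim :: "nat \<Rightarrow> nat \<Rightarrow> (nat \<Rightarrow> 'a::field) set set" where
  "subspaces_dim k d = {W. module.subspace scl W \<and> W \<subseteq> Fvecs k \<and> vector_space.dim scl W = d}"

definition PG_points :: "nat \<Rightarrow> (nat \<Rightarrow> 'a::field) set set" where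
  "PG_points k = subspaces_dim k 1"

definition PG_hyperplanes :: "nat \<Rightarrow> (nat \<Rightarrow> 'a::field) set set" where
  "PG_hyperplanes k = subspaces_dim k (k - 1)"

definition strong_blocking_set :: "nat \<Rightarrow> (nat \<Rightarrow> 'a::field) set set \<Rightarrow> bool" where
  "strong_blocking_set k S \<longleftrightarrow> S \<subseteq> PG_points k \<and>
     (\<forall>H \<in> PG_hyperplanes k. module.span scl (\<Union>{P \<in> S. P \<subseteq> H}) = H)"

text \<open>q-ary entropy and the MRRW function M_q.\<close>
definition Hq :: "real \<Rightarrow> real \<Rightarrow> real" where
  "Hq q x = x * log q (q - 1) - x * log q x - (1 - x) * log q (1 - x)"

definition Mq :: "real \<Rightarrow> real \<Rightarrow> real" where
  "Mq q \<delta> = Hq q ((q - 1 - (q - 2) * \<delta> - 2 * sqrt ((q - 1) * \<delta> * (1 - \<delta>))) / q)"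

end

theory Submission
  imports Defs "HOL-Library.Cardinality" "HOL-Analysis.Convex" "HOL-Computational_Algebra.Polynomial"
begin

text \<open>
  The points of a strong blocking set \<open>S\<close> are the columns of a generator matrix of a linear code
  of length \<open>card S\<close> and dimension \<open>k\<close>. A point set outside a hyperplane that blocks all other
  hyperplanes has more than \<open>(k - 1) * (q - 1)\<close> elements (Jamison), so the minimum distance is
  larger than \<open>(k - 1) * (q - 1)\<close>. Padding with zero columns to length about
  \<open>x * (q + 1) * (k - 1)\<close> gives relative distance at least \<open>(q - 1) / (x * (q + 1))\<close> and rate
  slightly above \<open>1 / (x * (q + 1))\<close>, which contradicts the MRRW bound when \<open>x\<close> is below the root.

  The MRRW bound for linear codes is obtained by the covering argument of Friedman--Tillich and
  Navon--Samorodnitsky: let \<open>f\<close> be a nonnegative function supported on a Hamming ball with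
  \<open>A f \<ge> l * f\<close>, where \<open>A\<close> is the adjacency operator of the Hamming graph. Its push-forward \<open>F\<close> along
  the generator matrix to \<open>F_q^k\<close> satisfies the same inequality for a Cayley graph whose nontrivial
  eigenvalues are at most \<open>(q - 1) * n - q * d\<close>. If \<open>l\<close> exceeds this number, \<open>F\<close> cannot be nearly
  orthogonal to the constants, so its support, hence the ball, has almost \<open>q ^ k\<close> elements.
\<close>

section \<open>Spectral bound for Cayley graphs of linear codes\<close>

definition ip :: "nat \<Rightarrow> (nat \<Rightarrow> 'a::field) \<Rightarrow> (nat \<Rightarrow> 'a) \<Rightarrow> 'a" where
  "ip k u v = (\<Sum>j<k. u j * v j)"

lemma ip_add_right: "ip k u (v + w) = ip k u v + ip k u w"
  and ip_diff_right: "ip k u (v - w) = ip k u v - ip k u w"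
  and ip_add_left: "ip k (v + w) u = ip k v u + ip k w u"
  and ip_scl_right: "ip k u (scl c v) = c * ip k u v"
  and ip_scl_left: "ip k (scl c v) u = c * ip k v u"
  and ip_zero_left: "ip k 0 u = 0"
  and ip_zero_right: "ip k u 0 = 0"
  by (simp_all add: ip_def scl_def algebra_simps sum.distrib sum_distrib_left sum_subtractf)

lemma Fvecs_0: "Fvecs 0 = {0}"
  by (auto simp: Fvecs_def)

lemma Fvecs_closed [simp, intro]:
  "0 \<in> Fvecs k"
  "u \<in> Fvecs k \<Longrightarrow> v \<in> Fvecs k \<Longrightarrow> u + v \<in> Fvecs k"
  "u \<in> Fvecs k \<Longrightarrow> v \<in> Fvecs k \<Longrightarrow> u - v \<in> Fvecs k"
  "v \<in> Fvecs k \<Longrightarrow> scl c v \<in> Fvecs k"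
  by (auto simp: Fvecs_def scl_def)

definition uvec :: "nat \<Rightarrow> nat \<Rightarrow> 'a::field" where
  "uvec i = (\<lambda>j. if j = i then 1 else 0)"

lemma uvec_in_Fvecs: "i < k \<Longrightarrow> uvec i \<in> Fvecs k"
  by (simp add: uvec_def Fvecs_def)

lemma uvec_nonzero: "uvec i \<noteq> 0"
proof
  assume "uvec i = (0 :: nat \<Rightarrow> 'a)"
  then have "uvec i i = (0 :: 'a)" by simp
  then show False by (simp add: uvec_def)
qed

lemma ip_uvec: "j < k \<Longrightarrow> ip k u (uvec j) = u j" "j < k \<Longrightarrow> ip k (uvec j) u = u j"
  by (simp_all add: ip_def uvec_def if_distrib [of "\<lambda>a. _ * a"] if_distrib [of "\<lambda>a. a * _"] cong: if_cong)

lemma Fvecs_nonzeroE: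
  assumes "v \<in> Fvecs k" "v \<noteq> 0"
  obtains j where "j < k" "v j \<noteq> 0"
proof -
  from assms(2) obtain j where "v j \<noteq> 0" by (auto simp: fun_eq_iff)
  moreover from this have "j < k" using assms(1) by (auto simp: Fvecs_def not_le[symmetric])
  ultimately show ?thesis using that by blast
qed

lemma sum_Fvecs_Suc:
  "(\<Sum>v\<in>Fvecs (Suc k). h v) = (\<Sum>v\<in>Fvecs k. \<Sum>a\<in>UNIV. h (v(k := a)))"
  for h :: "(nat \<Rightarrow> 'a::{finite,field}) \<Rightarrow> 'b::comm_monoid_add"
proof -
  have "(\<Sum>v\<in>Fvecs k. \<Sum>a\<in>UNIV. h (v(k := a))) = (\<Sum>(v, a)\<in>Fvecs k \<times> UNIV. h (v(k := a)))"
    by (rule sum.cartesian_product)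
  also have "\<dots> = (\<Sum>v\<in>Fvecs (Suc k). h v)"
    by (rule sum.reindex_bij_witness[of _ "\<lambda>v. (v(k := 0), v k)" "\<lambda>(v, a). v(k := a)"])
      (auto simp: Fvecs_def)
  finally show ?thesis by simp
qed

text \<open>Factoring over the coordinates serves three purposes: the cardinality of
  \<open>Fvecs k\<close>, the weight enumerator in \<open>card_ball_le\<close> and the power sums in
  \<open>sum_prod_affine_eq_0\<close>.\<close>

lemma prod_sum_Fvecs:
  "(\<Prod>i<k. \<Sum>a\<in>UNIV. f i a) = (\<Sum>v\<in>Fvecs k. \<Prod>i<k. f i (v i))"
  for f :: "nat \<Rightarrow> 'a::{finite,field} \<Rightarrow> 'b::comm_semiring_1"
proof (induction k)
  case 0
  show ?case by (simp add: Fvecs_0)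
next
  case (Suc k)
  have *: "(\<Prod>i<k. f i ((v(k := a)) i)) = (\<Prod>i<k. f i (v i))" for v a
    by (rule prod.cong) auto
  show ?case
    by (simp add: Suc sum_Fvecs_Suc * sum_distrib_left sum_distrib_right del: fun_upd_apply)
      (subst sum.swap, simp add: mult.commute)
qed

lemma finite_Fvecs [simp]: "finite (Fvecs k :: (nat \<Rightarrow> 'a::{finite,field}) set)"
proof (induction k)
  case 0
  show ?case by (simp add: Fvecs_0)
next
  case (Suc k)
  have "Fvecs (Suc k) \<subseteq> (\<lambda>(v, a::'a). v(k := a)) ` (Fvecs k \<times> UNIV)"
  proof
    fix v :: "nat \<Rightarrow> 'a" assume "v \<in> Fvecs (Suc k)"
    then show "v \<in> (\<lambda>(v, a::'a). v(k := a)) ` (Fvecs k \<times> UNIV)"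
      by (intro image_eqI[of _ _ "(v(k := 0), v k)"]) (auto simp: Fvecs_def fun_eq_iff)
  qed
  with Suc show ?case by (auto intro: finite_subset)
qed

lemma card_Fvecs: "card (Fvecs k :: (nat \<Rightarrow> 'a::{finite,field}) set) = CARD('a) ^ k"
  using prod_sum_Fvecs[where f = "\<lambda>_ (_::'a). 1::nat" and k = k] by simp

lemma sum_Fvecs_shift:
  assumes "u \<in> Fvecs k"
  shows "(\<Sum>v\<in>Fvecs k. h (v + u)) = (\<Sum>v\<in>Fvecs k. h v)"
  by (rule sum.reindex_bij_witness[of _ "\<lambda>v. v - u" "\<lambda>v. v + u"]) (use assms in auto)

lemma CARD_ge_2: "2 \<le> CARD('a::{finite,field})"
proof -
  have "card {0, 1::'a} \<le> CARD('a)" by (rule card_mono) auto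
  then show ?thesis by simp
qed

text \<open>As a function of two points, \<open>chi (ip k z y - ip k z y') / q^k\<close> is the kernel of the
  orthogonal projection onto the mean-zero functions of \<open>ip k z y\<close>. It is the sum of the
  additive characters in the nonzero multiples of \<open>z\<close>, so no complex characters are needed.\<close>

definition chi :: "'a::{finite,field} \<Rightarrow> real" where
  "chi s = (if s = 0 then real CARD('a) else 0) - 1"

lemma sum_affine:
  fixes h :: "'a::{finite,field} \<Rightarrow> 'b::comm_monoid_add"
  assumes "b \<noteq> 0"
  shows "(\<Sum>a\<in>UNIV. h (s - a * b)) = (\<Sum>a\<in>UNIV. h a)"
  by (rule sum.reindex_bij_witness[of _ "\<lambda>a. (s - a) / b" "\<lambda>a. s - a * b"]) (use assms in auto)

lemma sum_chi: "(\<Sum>a\<in>UNIV. chi a) = 0"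
  by (simp add: chi_def sum_subtractf)

text \<open>If \<open>b\<close> is nonzero, \<open>s - a * b\<close> runs through the whole field,
  where \<open>chi\<close> has mean zero, so omitting \<open>a = 0\<close> leaves
  \<open>- chi s\<close>. This is the eigenvalue equation behind
  \<open>sum_chi_cayley_op\<close>.\<close>

lemma sum_chi_nonzero:
  fixes s b :: "'a::{finite,field}"
  shows "(\<Sum>a\<in>UNIV - {0}. chi (s - a * b)) = chi b * chi s"
proof (cases "b = 0")
  case True
  then show ?thesis
    by (simp add: chi_def card_Diff_singleton of_nat_diff)
next
  case False
  have "(\<Sum>a\<in>UNIV. chi (s - a * b)) = 0"
    using sum_affine[OF False] sum_chi by metis
  then have "chi s + (\<Sum>a\<in>UNIV - {0}. chi (s - a * b)) = 0"
    by (subst (asm) sum.remove[of _ 0]) auto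
  with False show ?thesis by (simp add: chi_def)
qed

text \<open>Convolution with \<open>chi\<close>, divided by q, is a projection and hence idempotent;
  this makes \<open>chi_form\<close> a sum of squares.\<close>

lemma chi_convolution:
  fixes s t :: "'a::{finite,field}"
  shows "(\<Sum>c\<in>UNIV. chi (s - c) * chi (t - c)) = real CARD('a) * chi (s - t)"
proof -
  let ?q = "real CARD('a)"
  have "(\<Sum>c\<in>UNIV. chi (s - c) * chi (t - c)) =
    (\<Sum>c\<in>UNIV. (if c = s then ?q * chi (t - s) else 0) - chi (t - c))"
    by (rule sum.cong) (auto simp: chi_def algebra_simps)
  also have "\<dots> = ?q * chi (t - s) - (\<Sum>c\<in>UNIV. chi (t - c * 1))"
    by (simp add: sum_subtractf)
  also have "\<dots> = ?q * chi (t - s)"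
    by (subst sum_affine) (simp_all add: sum_chi)
  finally show ?thesis by (simp add: chi_def)
qed

text \<open>For \<open>y j \<noteq> 0\<close>, shifting \<open>z\<close> along \<open>uvec j\<close>
  moves \<open>ip k z y\<close> through all of F_q, so averaging over the shifts replaces
  \<open>chi\<close> by its mean zero.\<close>

lemma sum_chi_ip:
  assumes "y \<in> (Fvecs k :: (nat \<Rightarrow> 'a::{finite,field}) set)"
  shows "(\<Sum>z\<in>Fvecs k. chi (ip k z y)) = (if y = 0 then (real CARD('a) - 1) * real CARD('a) ^ k else 0)"
proof (cases "y = 0")
  case True
  then show ?thesis by (simp add: ip_zero_right chi_def card_Fvecs)
next
  case False
  then obtain j where j: "j < k" "y j \<noteq> 0" using assms Fvecs_nonzeroE by blast
  have *: "(\<Sum>z\<in>Fvecs k. chi (ip k z y)) = (\<Sum>z\<in>Fvecs k. chi (ip k z y - a * y j))" for a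
    using sum_Fvecs_shift[OF Fvecs_closed(4)[OF uvec_in_Fvecs[OF j(1)]], of "\<lambda>z. chi (ip k z y)" "-a"]
    by (simp add: ip_add_left ip_scl_left ip_uvec j)
  have "(\<Sum>a\<in>(UNIV::'a set). \<Sum>z\<in>Fvecs k. chi (ip k z y)) =
      (\<Sum>a\<in>UNIV. \<Sum>z\<in>Fvecs k. chi (ip k z y - a * y j))" 
    by (rule sum.cong[OF refl], rule *)
  also have "\<dots> = (\<Sum>z\<in>Fvecs k. \<Sum>a\<in>UNIV. chi (ip k z y - a * y j))"
    by (rule sum.swap)
  also have "\<dots> = 0" by (simp add: sum_affine[OF j(2)] sum_chi)
  finally show ?thesis using False by simp
qed

text \<open>\<open>chi\<close> is q - 1 at zero and -1 elsewhere, so each nonzero coordinate costs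
  q. This is how an eigenvalue measures a Hamming weight.\<close>

lemma sum_chi_weight:
  fixes b :: "nat \<Rightarrow> 'a::{finite,field}"
  shows "(\<Sum>i<n. chi (b i)) = (real CARD('a) - 1) * real n - real CARD('a) * real (card {i. i < n \<and> b i \<noteq> 0})"
proof -
  have "(\<Sum>i<n. chi (b i)) = (\<Sum>i<n. (real CARD('a) - 1) - (if b i \<noteq> 0 then real CARD('a) else 0))"
    by (rule sum.cong) (auto simp: chi_def)
  also have "\<dots> = (real CARD('a) - 1) * real n - real CARD('a) * real (card ({..<n} \<inter> {i. b i \<noteq> 0}))"
    by (simp add: sum_subtractf sum.If_cases)
  also have "{..<n} \<inter> {i. b i \<noteq> 0} = {i. i < n \<and> b i \<noteq> 0}" by auto
  finally show ?thesis .
qed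

section \<open>The Cayley graph of a generator matrix and its quadratic form\<close>

text \<open>Repeated and zero columns count with multiplicity, which suits the later padding by zero
  columns; \<open>g = uvec\<close> gives the Hamming graph.\<close>

definition cayley_op :: "nat \<Rightarrow> (nat \<Rightarrow> nat \<Rightarrow> 'a::{finite,field}) \<Rightarrow>
    ((nat \<Rightarrow> 'a) \<Rightarrow> real) \<Rightarrow> (nat \<Rightarrow> 'a) \<Rightarrow> real" where
  "cayley_op n g F y = (\<Sum>i<n. \<Sum>a\<in>UNIV - {0}. F (y + scl a (g i)))"

text \<open>A shift of the sum over \<open>y\<close> moves each translation from \<open>F\<close> to
  the kernel, where \<open>sum_chi_nonzero\<close> extracts the factor
  \<open>chi (ip k z (g i))\<close>.\<close>

lemma sum_chi_cayley_op:
  fixes F :: "(nat \<Rightarrow> 'a::{finite,field}) \<Rightarrow> real"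
  assumes g: "\<And>i. i < n \<Longrightarrow> g i \<in> Fvecs k"
  shows "(\<Sum>y\<in>Fvecs k. chi (ip k z y - s) * cayley_op n g F y) =
    (\<Sum>i<n. chi (ip k z (g i))) * (\<Sum>y\<in>Fvecs k. chi (ip k z y - s) * F y)"
proof -
  have "(\<Sum>y\<in>Fvecs k. chi (ip k z y - s) * cayley_op n g F y) =
    (\<Sum>y\<in>Fvecs k. \<Sum>i<n. \<Sum>a\<in>UNIV - {0}. chi (ip k z y - s) * F (y + scl a (g i)))"
    by (simp add: cayley_op_def sum_distrib_left)
  also have "\<dots> = (\<Sum>i<n. \<Sum>y\<in>Fvecs k. \<Sum>a\<in>UNIV - {0}. chi (ip k z y - s) * F (y + scl a (g i)))"
    by (rule sum.swap)
  also have "\<dots> = (\<Sum>i<n. \<Sum>a\<in>UNIV - {0}. \<Sum>y\<in>Fvecs k. chi (ip k z y - s) * F (y + scl a (g i)))"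
    by (intro sum.cong refl sum.swap)
  also have "\<dots> = (\<Sum>i<n. \<Sum>a\<in>UNIV - {0}. \<Sum>y\<in>Fvecs k. chi (ip k z y - s - a * ip k z (g i)) * F y)"
  proof (rule sum.cong[OF refl], rule sum.cong[OF refl])
    fix i and a :: 'a assume "i \<in> {..<n}" "a \<in> UNIV - {0}"
    then have "scl a (g i) \<in> Fvecs k" using g by auto
    from sum_Fvecs_shift[OF this, of "\<lambda>y. chi (ip k z y - s - a * ip k z (g i)) * F y"]
    show "(\<Sum>y\<in>Fvecs k. chi (ip k z y - s) * F (y + scl a (g i))) =
        (\<Sum>y\<in>Fvecs k. chi (ip k z y - s - a * ip k z (g i)) * F y)"
      by (simp add: ip_add_right ip_scl_right)
  qed
  also have "\<dots> = (\<Sum>i<n. \<Sum>y\<in>Fvecs k. \<Sum>a\<in>UNIV - {0}. chi (ip k z y - s - a * ip k z (g i)) * F y)"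
    by (intro sum.cong refl sum.swap)
  also have "\<dots> = (\<Sum>i<n. \<Sum>y\<in>Fvecs k. chi (ip k z (g i)) * (chi (ip k z y - s) * F y))"
    by (simp add: sum_distrib_right[symmetric] sum_chi_nonzero mult.assoc)
  finally show ?thesis
    by (simp add: sum_distrib_left[symmetric] sum_distrib_right)
qed

text \<open>In Fourier terms: the sum, over the nonzero multipliers of \<open>z\<close>, of the
  coefficient of \<open>F\<close> times the conjugate coefficient of \<open>H\<close>.\<close>

definition chi_form :: "nat \<Rightarrow> (nat \<Rightarrow> 'a::{finite,field}) \<Rightarrow> ((nat \<Rightarrow> 'a) \<Rightarrow> real) \<Rightarrow>
    ((nat \<Rightarrow> 'a) \<Rightarrow> real) \<Rightarrow> real" where
  "chi_form k z F H = (\<Sum>y'\<in>Fvecs k. (\<Sum>y\<in>Fvecs k. chi (ip k z y - ip k z y') * F y) * H y')"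

text \<open>Parseval's identity. Each character is counted once for every nonzero multiplier, hence
  the factor q - 1.\<close>

lemma sum_chi_form:
  fixes F H :: "(nat \<Rightarrow> 'a::{finite,field}) \<Rightarrow> real"
  shows "(\<Sum>z\<in>Fvecs k. chi_form k z F H) =
    (real CARD('a) - 1) * real CARD('a) ^ k * (\<Sum>y\<in>Fvecs k. F y * H y)"
proof -
  have "(\<Sum>z\<in>Fvecs k. chi_form k z F H) =
    (\<Sum>y'\<in>Fvecs k. \<Sum>z\<in>Fvecs k. (\<Sum>y\<in>Fvecs k. chi (ip k z (y - y')) * F y) * H y')"
    unfolding chi_form_def ip_diff_right by (rule sum.swap)
  also have "\<dots> = (\<Sum>y'\<in>Fvecs k. (\<Sum>z\<in>Fvecs k. \<Sum>y\<in>Fvecs k. chi (ip k z (y - y')) * F y) * H y')"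
    by (simp add: sum_distrib_right)
  also have "\<dots> = (\<Sum>y'\<in>Fvecs k. (\<Sum>y\<in>Fvecs k. \<Sum>z\<in>Fvecs k. chi (ip k z (y - y')) * F y) * H y')"
    by (intro sum.cong refl arg_cong2[of _ _ _ _ "(*)"] sum.swap)
  also have "\<dots> = (\<Sum>y'\<in>Fvecs k. (\<Sum>y\<in>Fvecs k.
      if y = y' then (real CARD('a) - 1) * real CARD('a) ^ k * F y else 0) * H y')"
    by (intro sum.cong refl arg_cong2[of _ _ _ _ "(*)"])
       (simp add: sum_distrib_right[symmetric] sum_chi_ip)
  finally show ?thesis by (simp add: sum_distrib_left mult_ac)
qed

lemma chi_form_nonneg: "0 \<le> chi_form k z F F"
  for F :: "(nat \<Rightarrow> 'a::{finite,field}) \<Rightarrow> real"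
proof -
  have "real CARD('a) * chi_form k z F F =
    (\<Sum>y'\<in>Fvecs k. \<Sum>y\<in>Fvecs k. \<Sum>c\<in>UNIV. chi (ip k z y - c) * F y * (chi (ip k z y' - c) * F y'))"
    unfolding chi_form_def
    by (simp add: sum_distrib_left sum_distrib_right mult_ac flip: chi_convolution)
  also have "\<dots> = (\<Sum>y'\<in>Fvecs k. \<Sum>c\<in>UNIV. \<Sum>y\<in>Fvecs k. chi (ip k z y - c) * F y * (chi (ip k z y' - c) * F y'))"
    by (intro sum.cong refl sum.swap)
  also have "\<dots> = (\<Sum>c\<in>UNIV. \<Sum>y'\<in>Fvecs k. \<Sum>y\<in>Fvecs k. chi (ip k z y - c) * F y * (chi (ip k z y' - c) * F y'))"
    by (rule sum.swap)
  also have "\<dots> = (\<Sum>c\<in>UNIV. (\<Sum>y\<in>Fvecs k. chi (ip k z y - c) * F y)\<^sup>2)"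
    by (simp add: sum_distrib_left sum_distrib_right power2_eq_square)
  also have "\<dots> \<ge> 0" by (intro sum_nonneg) auto
  finally show ?thesis by (simp add: zero_le_mult_iff)
qed

lemma chi_form_zero:
  "chi_form k 0 F F = (real CARD('a) - 1) * (\<Sum>y\<in>Fvecs k. F y)\<^sup>2"
  for F :: "(nat \<Rightarrow> 'a::{finite,field}) \<Rightarrow> real"
  by (simp add: chi_form_def ip_zero_left chi_def power2_eq_square sum_distrib_left[symmetric] sum_distrib_right[symmetric])

text \<open>The Cayley graph generated by the nonzero multiples of the columns \<open>g i\<close> has the eigenvalues
  \<open>(q - 1) * n - q * w\<close>, where \<open>w\<close> runs through the weights of the codewords generated by \<open>g\<close>.\<close>

lemma cayley_op_form_le:
  fixes F :: "(nat \<Rightarrow> 'a::{finite,field}) \<Rightarrow> real"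
  assumes g: "\<And>i. i < n \<Longrightarrow> g i \<in> Fvecs k"
    and d: "\<And>z. z \<in> Fvecs k \<Longrightarrow> z \<noteq> 0 \<Longrightarrow> d \<le> card {i. i < n \<and> ip k z (g i) \<noteq> 0}"
  defines "q \<equiv> real CARD('a)"
  shows "q ^ k * (\<Sum>y\<in>Fvecs k. cayley_op n g F y * F y) \<le>
    ((q - 1) * real n - q * real d) * q ^ k * (\<Sum>y\<in>Fvecs k. F y * F y) + q * real d * (\<Sum>y\<in>Fvecs k. F y)\<^sup>2"
proof -
  define l where "l = (q - 1) * real n - q * real d"
  have q: "q \<ge> 2" using CARD_ge_2[where 'a = 'a] by (simp add: q_def)
  have "(q - 1) * (q ^ k * (\<Sum>y\<in>Fvecs k. cayley_op n g F y * F y)) = (\<Sum>z\<in>Fvecs k. chi_form k z (cayley_op n g F) F)"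
    unfolding q_def by (simp add: sum_chi_form)
  also have "\<dots> = (\<Sum>z\<in>Fvecs k. (\<Sum>i<n. chi (ip k z (g i))) * chi_form k z F F)"
    unfolding chi_form_def
    by (simp add: sum_chi_cayley_op[OF g] mult.assoc flip: sum_distrib_left)
  \<comment> \<open>For \<open>z = 0\<close> the eigenvalue is \<open>l + q * real d\<close>; the
    second summand carries this excess over the bound \<open>l\<close> that holds for all other
    \<open>z\<close>.\<close>
  also have "\<dots> \<le> (\<Sum>z\<in>Fvecs k. l * chi_form k z F F + (if z = 0 then q * real d * chi_form k z F F else 0))"
  proof (intro sum_mono)
    fix z :: "nat \<Rightarrow> 'a" assume z: "z \<in> Fvecs k"
    show "(\<Sum>i<n. chi (ip k z (g i))) * chi_form k z F F \<le>
        l * chi_form k z F F + (if z = 0 then q * real d * chi_form k z F F else 0)"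
    proof (cases "z = 0")
      case True
      have "(\<Sum>i<n. chi (ip k 0 (g i))) = l + q * real d"
        by (simp add: ip_zero_left chi_def l_def q_def)
      with True show ?thesis by (simp add: distrib_right)
    next
      case False
      then have "(\<Sum>i<n. chi (ip k z (g i))) \<le> l"
        using d[OF z False] unfolding sum_chi_weight l_def q_def by simp
      then have "(\<Sum>i<n. chi (ip k z (g i))) * chi_form k z F F \<le> l * chi_form k z F F"
        by (rule mult_right_mono[OF _ chi_form_nonneg])
      with False show ?thesis by simp
    qed
  qed
  also have "\<dots> = l * (\<Sum>z\<in>Fvecs k. chi_form k z F F) + q * real d * chi_form k 0 F F"
    by (simp add: sum.distrib sum_distrib_left)
  also have "\<dots> = (q - 1) * (l * q ^ k * (\<Sum>y\<in>Fvecs k. F y * F y) + q * real d * (\<Sum>y\<in>Fvecs k. F y)\<^sup>2)"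
    unfolding sum_chi_form chi_form_zero by (simp add: q_def algebra_simps)
  finally show ?thesis using q unfolding l_def by (elim mult_left_le_imp_le) simp
qed

section \<open>Hamming balls\<close>

definition lincomb :: "nat \<Rightarrow> (nat \<Rightarrow> nat \<Rightarrow> 'a::field) \<Rightarrow> (nat \<Rightarrow> 'a) \<Rightarrow> nat \<Rightarrow> 'a" where
  "lincomb n g x = (\<lambda>j. \<Sum>i<n. x i * g i j)"

lemma lincomb_in_Fvecs: "(\<And>i. i < n \<Longrightarrow> g i \<in> Fvecs k) \<Longrightarrow> lincomb n g x \<in> Fvecs k"
  by (simp add: lincomb_def Fvecs_def)

lemma lincomb_add_uvec:
  assumes "i < n"
  shows "lincomb n g (x + scl a (uvec i)) = lincomb n g x + scl a (g i)"
proof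
  fix j
  have "(\<Sum>l<n. a * uvec i l * g l j) = (\<Sum>l<n. if l = i then a * g i j else 0)"
    by (rule sum.cong) (auto simp: uvec_def)
  with assms show "lincomb n g (x + scl a (uvec i)) j = (lincomb n g x + scl a (g i)) j"
    by (simp add: lincomb_def scl_def distrib_right sum.distrib)
qed

definition pushfwd :: "nat \<Rightarrow> (nat \<Rightarrow> nat \<Rightarrow> 'a::{finite,field}) \<Rightarrow> ((nat \<Rightarrow> 'a) \<Rightarrow> real) \<Rightarrow>
    (nat \<Rightarrow> 'a) \<Rightarrow> real" where
  "pushfwd n g f y = (\<Sum>x\<in>{x \<in> Fvecs n. lincomb n g x = y}. f x)"

text \<open>\<open>lincomb n g\<close> maps a step by \<open>scl a (uvec i)\<close> to a step by
  \<open>scl a (g i)\<close>, so summation over its fibres intertwines the two adjacency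
  operators.\<close>

lemma cayley_op_pushfwd:
  "cayley_op n g (pushfwd n g f) y = pushfwd n g (cayley_op n uvec f) y"
proof -
  have "pushfwd n g f (y + scl a (g i)) =
      (\<Sum>x\<in>{x \<in> Fvecs n. lincomb n g x = y}. f (x + scl a (uvec i)))" if "i < n" for i a
  proof -
    have u: "scl a (uvec i) \<in> Fvecs n" using uvec_in_Fvecs[OF that] by auto
    have "lincomb n g (x - scl a (uvec i)) = lincomb n g x - scl a (g i)" for x
      using lincomb_add_uvec[OF that, of g "x - scl a (uvec i)" a] by simp
    with u show ?thesis unfolding pushfwd_def
      by (intro sum.reindex_bij_witness[of _ "\<lambda>x. x + scl a (uvec i)" "\<lambda>x. x - scl a (uvec i)"])
        (auto simp: lincomb_add_uvec[OF that])
  qed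
  then have "cayley_op n g (pushfwd n g f) y =
    (\<Sum>i<n. \<Sum>a\<in>UNIV - {0}. \<Sum>x\<in>{x \<in> Fvecs n. lincomb n g x = y}. f (x + scl a (uvec i)))"
    by (simp add: cayley_op_def)
  also have "\<dots> = (\<Sum>i<n. \<Sum>x\<in>{x \<in> Fvecs n. lincomb n g x = y}. \<Sum>a\<in>UNIV - {0}. f (x + scl a (uvec i)))"
    by (intro sum.cong refl sum.swap)
  also have "\<dots> = (\<Sum>x\<in>{x \<in> Fvecs n. lincomb n g x = y}. \<Sum>i<n. \<Sum>a\<in>UNIV - {0}. f (x + scl a (uvec i)))"
    by (rule sum.swap)
  finally show ?thesis by (simp add: pushfwd_def cayley_op_def)
qed

section \<open>Radial functions on the Hamming graph\<close>

definition wt :: "nat \<Rightarrow> (nat \<Rightarrow> 'a::field) \<Rightarrow> nat" where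
  "wt n x = card {i. i < n \<and> x i \<noteq> 0}"

lemma wt_add_uvec:
  assumes "i < n"
  shows "wt n (x + scl a (uvec i)) =
    card ({j. j < n \<and> x j \<noteq> 0} - {i}) + (if x i + a = 0 then 0 else 1)"
proof -
  have "{j. j < n \<and> (x + scl a (uvec i)) j \<noteq> 0} =
    ({j. j < n \<and> x j \<noteq> 0} - {i}) \<union> (if x i + a = 0 then {} else {i})"
    using assms by (auto simp: scl_def uvec_def)
  then have "wt n (x + scl a (uvec i)) =
      card (({j. j < n \<and> x j \<noteq> 0} - {i}) \<union> (if x i + a = 0 then {} else {i}))"
    by (simp only: wt_def)
  also have "\<dots> = card ({j. j < n \<and> x j \<noteq> 0} - {i}) + (if x i + a = 0 then 0 else 1)"
    by (subst card_Un_disjoint) auto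
  finally show ?thesis .
qed

lemma wt_le: "wt n x \<le> n"
proof -
  have "wt n x \<le> card {..<n}" unfolding wt_def by (rule card_mono) auto
  then show ?thesis by simp
qed

text \<open>At a zero coordinate every nonzero shift raises the weight. At a nonzero one only
  \<open>a = - x i\<close> lowers it, and the other q - 2 shifts preserve it.\<close>

lemma sum_nonzero_shifts:
  fixes x :: "nat \<Rightarrow> 'a::{finite,field}" and \<phi> :: "nat \<Rightarrow> real"
  assumes "i < n"
  shows "(\<Sum>a\<in>UNIV - {0}. \<phi> (wt n (x + scl a (uvec i)))) =
    (if x i = 0 then (real CARD('a) - 1) * \<phi> (wt n x + 1)
     else \<phi> (wt n x - 1) + (real CARD('a) - 2) * \<phi> (wt n x))"
proof (cases "x i = 0")
  case True
  then have "card ({j. j < n \<and> x j \<noteq> 0} - {i}) = wt n x"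
    unfolding wt_def by (intro arg_cong[of _ _ card]) auto
  with True assms show ?thesis
    by (simp add: wt_add_uvec of_nat_diff card_Diff_singleton)
next
  case False
  have "card ({j. j < n \<and> x j \<noteq> 0} - {i}) = wt n x - 1"
    using False assms by (simp add: wt_def card_Diff_singleton)
  moreover have "wt n x \<noteq> 0" using False assms by (auto simp: wt_def)
  ultimately have *: "\<phi> (wt n (x + scl a (uvec i))) =
      (if a = - x i then \<phi> (wt n x - 1) else \<phi> (wt n x))" for a
    using assms by (auto simp: wt_add_uvec add_eq_0_iff)
  have "(\<Sum>a\<in>UNIV - {0}. \<phi> (wt n (x + scl a (uvec i)))) =
      \<phi> (wt n x - 1) + (\<Sum>a\<in>UNIV - {0} - {- x i}. \<phi> (wt n x))"
    unfolding * using False by (subst sum.remove[of _ "- x i"]) (auto intro: sum.cong)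
  also have "card (UNIV - {0} - {- x i}) = CARD('a) - 2"
    using False by (simp add: card_Diff_singleton)
  then have "(\<Sum>a\<in>UNIV - {0} - {- x i}. \<phi> (wt n x)) = (real CARD('a) - 2) * \<phi> (wt n x)"
    using CARD_ge_2[where 'a = 'a] by (simp add: of_nat_diff)
  finally show ?thesis unfolding if_not_P[OF False] .
qed

text \<open>\<open>sum_nonzero_shifts\<close> is summed over the nonzero and the zero coordinates.
  The truncated \<open>wt n x - 1\<close> at weight 0 has coefficient zero.\<close>

lemma cayley_op_radial:
  fixes x :: "nat \<Rightarrow> 'a::{finite,field}" and \<phi> :: "nat \<Rightarrow> real"
  shows "cayley_op n uvec (\<lambda>x. \<phi> (wt n x)) x =
    real (wt n x) * \<phi> (wt n x - 1) + real (wt n x) * (real CARD('a) - 2) * \<phi> (wt n x)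
    + (real n - real (wt n x)) * (real CARD('a) - 1) * \<phi> (wt n x + 1)"
proof -
  have "card ({..<n} \<inter> {i. x i = 0}) = card ({..<n} - {i. i < n \<and> x i \<noteq> 0})"
    by (rule arg_cong[of _ _ card]) auto
  also have "\<dots> = n - wt n x"
    by (subst card_Diff_subset) (auto simp: wt_def)
  finally have z: "card ({..<n} \<inter> {i. x i = 0}) = n - wt n x" .
  have nz: "card ({..<n} \<inter> - {i. x i = 0}) = wt n x"
    unfolding wt_def by (rule arg_cong[of _ _ card]) auto
  have "cayley_op n uvec (\<lambda>x. \<phi> (wt n x)) x =
    (\<Sum>i<n. if x i = 0 then (real CARD('a) - 1) * \<phi> (wt n x + 1)
     else \<phi> (wt n x - 1) + (real CARD('a) - 2) * \<phi> (wt n x))"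
    unfolding cayley_op_def by (intro sum.cong) (auto simp: sum_nonzero_shifts)
  then show ?thesis using wt_le[of n x]
    by (simp add: sum.If_cases z nz of_nat_diff algebra_simps)
qed

text \<open>The Hamming graph acts on radial functions as a tridiagonal matrix. Over a window of bounded
  length its coefficients are nearly constant; the factor \<open>t ^ j\<close> symmetrises it, and the sine is
  the Perron eigenvector of a path with \<open>m\<close> vertices, with eigenvalue \<open>2 * cos (pi / (m + 1))\<close>.\<close>

definition bump :: "nat \<Rightarrow> nat \<Rightarrow> real \<Rightarrow> nat \<Rightarrow> real" where
  "bump s m t w = (if s \<le> w \<and> w \<le> s + m + 1
     then t ^ (w - s) * sin (pi * real (w - s) / (real m + 1)) else 0)"

lemma bump_nonneg:
  assumes "0 \<le> t"
  shows "0 \<le> bump s m t w"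
proof (cases "s \<le> w \<and> w \<le> s + m + 1")
  case True
  then have "real (w - s) \<le> real m + 1" by linarith
  then have "pi * real (w - s) / (real m + 1) \<le> pi"
    by (simp add: divide_le_eq mult_left_mono)
  then have "0 \<le> sin (pi * real (w - s) / (real m + 1))"
    by (intro sin_ge_zero) auto
  then show ?thesis using assms by (simp add: bump_def del: of_nat_diff)
qed (auto simp: bump_def)

lemma bump_eq_0: "s + m < w \<Longrightarrow> bump s m t w = 0"
  by (cases "w = s + m + 1") (auto simp: bump_def add.commute)

lemma bump_Suc_pos:
  assumes "0 < t" "1 \<le> m"
  shows "0 < bump s m t (Suc s)"
proof -
  have "pi / (real m + 1) < pi" using assms by (simp add: divide_less_eq)
  then have "0 < sin (pi / (real m + 1))" by (intro sin_gt_zero) auto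
  with assms show ?thesis by (simp add: bump_def)
qed

text \<open>Inside the window the coefficients are at least their minima \<open>s\<close>
  (downwards) and \<open>b\<close> (upwards). For these constant coefficients the bump is an exact
  eigenvector, by the addition formula for the sine and \<open>b * t\<^sup>2 = s\<close>. Elsewhere
  the bump vanishes and the right side is nonnegative.\<close>

lemma bump_subsolution:
  fixes q :: real
  assumes q: "2 \<le> q" and s: "0 < s" and n: "s + m < n" and w: "w \<le> n"
  defines "b \<equiv> (real n - real (s + m)) * (q - 1)"
  defines "t \<equiv> sqrt (real s / b)"
  shows "(real s * (q - 2) + 2 * cos (pi / (real m + 1)) * sqrt (real s * b)) * bump s m t w \<le>
    real w * bump s m t (w - 1) + real w * (q - 2) * bump s m t w
    + (real n - real w) * (q - 1) * bump s m t (w + 1)"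
proof -
  let ?p = "bump s m t"
  have b: "b > 0" using q n by (simp add: b_def)
  have t: "t > 0" using s b by (simp add: t_def)
  note nonneg = bump_nonneg[OF less_imp_le[OF t], of s m]
  show ?thesis
  proof (cases "s < w \<and> w \<le> s + m")
    case False
    then consider "w < s" | "w = s" | "s + m < w" by linarith
    then have "?p w = 0"
      by cases (auto simp: bump_eq_0, auto simp: bump_def)
    moreover have "0 \<le> real w * ?p (w - 1) + (real n - real w) * (q - 1) * ?p (w + 1)"
      using nonneg w q by (intro add_nonneg_nonneg mult_nonneg_nonneg) auto
    ultimately show ?thesis by simp
  next
    case True
    then obtain j where j: "w = s + Suc j" "Suc j \<le> m"
      by (metis add_le_cancel_left less_imp_Suc_add add_Suc_right)
    define \<theta> where "\<theta> = pi / (real m + 1)"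
    \<comment> \<open>Allowing \<open>i = 0\<close> and \<open>i = m + 1\<close> includes the two
      zeros of the sine, so the ends of the window need no separate treatment.\<close>
    have at: "?p (s + i) = t ^ i * sin (real i * \<theta>)" if "i \<le> m + 1" for i
      using that by (simp add: bump_def \<theta>_def mult.commute)
    have p0: "?p (w - 1) = t ^ j * sin (real (Suc j) * \<theta> - \<theta>)"
      using at[of j] j by (simp add: algebra_simps)
    have p1: "?p w = t * t ^ j * sin (real (Suc j) * \<theta>)"
      using at[of "Suc j"] j by simp
    have p2: "?p (w + 1) = t ^ j * t\<^sup>2 * sin (real (Suc j) * \<theta> + \<theta>)"
      using at[of "Suc (Suc j)"] j by (simp add: power2_eq_square algebra_simps)
    have sq: "sqrt (real s * b) * t = real s"
      using s b by (simp add: t_def real_sqrt_mult[symmetric])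
    have bt: "b * t\<^sup>2 = real s"
      using s b by (simp add: t_def)
    have "2 * cos \<theta> * sqrt (real s * b) * ?p w =
      (sqrt (real s * b) * t) * t ^ j * (2 * cos \<theta> * sin (real (Suc j) * \<theta>))"
      by (simp only: p1 mult_ac)
    also have "\<dots> = real s * (t ^ j * (sin (real (Suc j) * \<theta> - \<theta>) + sin (real (Suc j) * \<theta> + \<theta>)))"
      unfolding sq by (simp only: sin_add sin_diff) (simp add: algebra_simps)
    also have "\<dots> = real s * ?p (w - 1) + b * ?p (w + 1)"
      unfolding p0 p2 using bt by (simp add: algebra_simps)
    finally have *: "2 * cos \<theta> * sqrt (real s * b) * ?p w = real s * ?p (w - 1) + b * ?p (w + 1)" .
    have "real s * ?p (w - 1) \<le> real w * ?p (w - 1)"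
      using True nonneg by (intro mult_right_mono) auto
    moreover have "b * ?p (w + 1) \<le> (real n - real w) * (q - 1) * ?p (w + 1)"
      unfolding b_def using True nonneg q by (intro mult_right_mono) auto
    moreover have "real s * (q - 2) * ?p w \<le> real w * (q - 2) * ?p w"
      using True nonneg q by (intro mult_right_mono) auto
    ultimately show ?thesis using * by (simp add: distrib_right \<theta>_def)
  qed
qed

section \<open>The covering argument and the size of balls\<close>

text \<open>The quadratic form of the push-forward \<open>F\<close> is bounded below by the
  subsolution property and above by the spectrum. Only the component of \<open>F\<close> along the
  constants can supply the surplus \<open>\<eta>\<close>, and a small support limits that
  component.\<close>

lemma linear_code_size_le_ball:
  fixes g :: "nat \<Rightarrow> nat \<Rightarrow> 'a::{finite,field}"
  assumes g: "\<And>i. i < n \<Longrightarrow> g i \<in> Fvecs k"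
    and d: "\<And>z. z \<in> Fvecs k \<Longrightarrow> z \<noteq> 0 \<Longrightarrow> d \<le> card {i. i < n \<and> ip k z (g i) \<noteq> 0}"
    and s: "0 < s" and m: "1 \<le> m" and n: "s + m < n"
  defines "q \<equiv> real CARD('a)"
  assumes \<eta>: "(q - 1) * real n - q * real d + \<eta> \<le>
    real s * (q - 2) + 2 * cos (pi / (real m + 1)) * sqrt (real s * ((real n - real (s + m)) * (q - 1)))"
  shows "\<eta> * q ^ k \<le> q * real d * real (card {x \<in> (Fvecs n :: (nat \<Rightarrow> 'a) set). wt n x \<le> s + m})"
proof -
  define l where "l = real s * (q - 2) + 2 * cos (pi / (real m + 1)) * sqrt (real s * ((real n - real (s + m)) * (q - 1)))"
  define t where "t = sqrt (real s / ((real n - real (s + m)) * (q - 1)))"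
  have q: "2 \<le> q" using CARD_ge_2[where 'a = 'a] by (simp add: q_def)
  have t: "0 < t" using q s n by (simp add: t_def)
  define f :: "(nat \<Rightarrow> 'a) \<Rightarrow> real" where "f = (\<lambda>x. bump s m t (wt n x))"
  define F where "F = pushfwd n g f"
  let ?V = "Fvecs k :: (nat \<Rightarrow> 'a) set"
  let ?ball = "{x \<in> (Fvecs n :: (nat \<Rightarrow> 'a) set). wt n x \<le> s + m}"
  have f_nonneg: "0 \<le> f x" for x
    using t by (simp add: f_def bump_nonneg)
  then have F_nonneg: "0 \<le> F y" for y
    unfolding F_def pushfwd_def by (intro sum_nonneg) auto
  have "l * f x \<le> cayley_op n uvec f x" for x
    unfolding f_def cayley_op_radial l_def t_def q_def
    by (rule bump_subsolution) (use s n wt_le CARD_ge_2 in auto)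
  then have "l * F y \<le> cayley_op n g F y" for y
    unfolding F_def cayley_op_pushfwd unfolding pushfwd_def sum_distrib_left by (intro sum_mono)
  then have AF: "l * (\<Sum>y\<in>?V. F y * F y) \<le> (\<Sum>y\<in>?V. cayley_op n g F y * F y)"
    unfolding sum_distrib_left mult.assoc[symmetric] by (intro sum_mono mult_right_mono F_nonneg)
  have supp: "F y = 0" if "y \<notin> lincomb n g ` ?ball" for y
    unfolding F_def pushfwd_def f_def
    by (rule sum.neutral) (use that in \<open>auto intro!: bump_eq_0 simp: not_le[symmetric]\<close>)
  \<comment> \<open>\<open>F\<close> vanishes outside the image of the ball, so Cauchy-Schwarz
    against the constant 1 there brings in the size of the ball.\<close>
  have "(\<Sum>y\<in>?V. F y)\<^sup>2 = (\<Sum>y\<in>lincomb n g ` ?ball. F y * 1)\<^sup>2"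
    by (rule arg_cong[of _ _ "\<lambda>a. a\<^sup>2"], simp, rule sum.mono_neutral_right)
      (auto simp: supp lincomb_in_Fvecs g)
  also have "\<dots> \<le> (\<Sum>y\<in>lincomb n g ` ?ball. (F y)\<^sup>2) * (\<Sum>y\<in>lincomb n g ` ?ball. 1\<^sup>2)"
    by (rule Cauchy_Schwarz_ineq_sum)
  also have "(\<Sum>y\<in>lincomb n g ` ?ball. (F y)\<^sup>2) = (\<Sum>y\<in>?V. F y * F y)"
    unfolding power2_eq_square
    by (rule sum.mono_neutral_left) (auto simp: supp lincomb_in_Fvecs g)
  also have "(\<Sum>y\<in>lincomb n g ` ?ball. 1\<^sup>2) \<le> real (card ?ball)"
    by (simp add: card_image_le)
  finally have CS: "(\<Sum>y\<in>?V. F y)\<^sup>2 \<le> (\<Sum>y\<in>?V. F y * F y) * real (card ?ball)"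
    by (simp add: mult_left_mono sum_nonneg)
  have pos: "0 < (\<Sum>y\<in>?V. F y * F y)"
  proof -
    \<comment> \<open>A vector of weight \<open>Suc s\<close>, where the bump is positive, shows
      that \<open>F\<close> is not zero.\<close>
    define x0 :: "nat \<Rightarrow> 'a" where "x0 = (\<lambda>i. if i < Suc s then 1 else 0)"
    have "{i. i < n \<and> x0 i \<noteq> 0} = {..<Suc s}" using n m by (auto simp: x0_def)
    then have "wt n x0 = Suc s" by (simp add: wt_def)
    then have "0 < f x0" using bump_Suc_pos[OF t m] by (simp add: f_def)
    moreover have x0: "x0 \<in> Fvecs n" using n m by (simp add: x0_def Fvecs_def)
    ultimately have "0 < F (lincomb n g x0)"
      unfolding F_def pushfwd_def by (intro sum_pos2[of _ x0]) (auto simp: f_nonneg)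
    then show ?thesis
      by (intro sum_pos2[of _ "lincomb n g x0"]) (auto simp: lincomb_in_Fvecs g)
  qed
  let ?N = "\<Sum>y\<in>?V. F y * F y"
  have "((q - 1) * real n - q * real d + \<eta>) * (q ^ k * ?N) \<le> l * (q ^ k * ?N)"
    using \<eta> pos q unfolding l_def by (intro mult_right_mono) auto
  also have "\<dots> \<le> q ^ k * (\<Sum>y\<in>?V. cayley_op n g F y * F y)"
    using AF q by (simp add: mult.left_commute[of l])
  also have "\<dots> \<le> ((q - 1) * real n - q * real d) * q ^ k * ?N + q * real d * (\<Sum>y\<in>?V. F y)\<^sup>2"
    unfolding q_def by (rule cayley_op_form_le[OF g d])
  also have "q * real d * (\<Sum>y\<in>?V. F y)\<^sup>2 \<le> q * real d * (?N * real (card ?ball))"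
    using CS q by (intro mult_left_mono) auto
  finally have "(\<eta> * q ^ k) * ?N \<le> (q * real d * real (card ?ball)) * ?N"
    by (simp add: algebra_simps)
  then show ?thesis using pos by simp
qed

text \<open>Chernoff's method: in the weight enumerator at \<open>t \<le> 1\<close>, every vector of
  the ball contributes at least \<open>t ^ r\<close>.\<close>

lemma card_ball_le:
  fixes t :: real
  assumes "0 < t" "t \<le> 1"
  shows "real (card {x \<in> (Fvecs n :: (nat \<Rightarrow> 'a::{finite,field}) set). wt n x \<le> r}) * t ^ r \<le>
    (1 + (real CARD('a) - 1) * t) ^ n"
proof -
  let ?h = "\<lambda>a::'a. if a = 0 then 1 else t"
  have "(\<Prod>i<n. ?h (x i)) = t ^ wt n x" for x :: "nat \<Rightarrow> 'a"
  proof -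
    have "{..<n} \<inter> - {i. x i = 0} = {i. i < n \<and> x i \<noteq> 0}" by auto
    then show ?thesis by (simp add: prod.If_cases wt_def)
  qed
  moreover have "(\<Sum>a\<in>UNIV. ?h a) = 1 + (real CARD('a) - 1) * t"
    by (subst sum.remove[of _ 0]) (auto simp: card_Diff_singleton of_nat_diff)
  ultimately have eq: "(1 + (real CARD('a) - 1) * t) ^ n = (\<Sum>x\<in>(Fvecs n :: (nat \<Rightarrow> 'a) set). t ^ wt n x)"
    using prod_sum_Fvecs[of "\<lambda>_. ?h" n] by simp
  have "real (card {x \<in> (Fvecs n :: (nat \<Rightarrow> 'a) set). wt n x \<le> r}) * t ^ r =
      (\<Sum>x | x \<in> (Fvecs n :: (nat \<Rightarrow> 'a) set) \<and> wt n x \<le> r. t ^ r)" by simp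
  also have "\<dots> \<le> (\<Sum>x | x \<in> (Fvecs n :: (nat \<Rightarrow> 'a) set) \<and> wt n x \<le> r. t ^ wt n x)"
    using assms by (intro sum_mono power_decreasing) auto
  also have "\<dots> \<le> (\<Sum>x\<in>(Fvecs n :: (nat \<Rightarrow> 'a) set). t ^ wt n x)"
    using assms by (intro sum_mono2) auto
  finally show ?thesis unfolding eq .
qed

section \<open>Strong blocking sets and minimum distance\<close>

text \<open>For \<open>e > 0\<close> the polynomial \<open>x ^ e - 1\<close> has fewer than q - 1
  roots, so some nonzero \<open>b\<close> has \<open>b ^ e \<noteq> 1\<close>, and substituting
  \<open>a * b\<close> multiplies the sum by \<open>b ^ e\<close>. For \<open>e = 0\<close> the sum
  is q in the field, that is 0.\<close>

lemma sum_field_power: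
  fixes e :: nat
  assumes "e < CARD('a::{finite,field}) - 1"
  shows "(\<Sum>a\<in>UNIV. (a::'a) ^ e) = 0"
proof (cases "e = 0")
  case True
  have "(\<Sum>a\<in>UNIV. (a::'a)) = (\<Sum>a\<in>UNIV. a + 1)"
    by (rule sum.reindex_bij_witness[of _ "\<lambda>a. a + 1" "\<lambda>a. a - 1"]) auto
  then have "of_nat CARD('a) = (0::'a)" by (simp add: sum.distrib)
  with True show ?thesis by simp
next
  case False
  let ?p = "monom 1 e - 1 :: 'a poly"
  have "coeff ?p e = 1" using False by simp
  then have "?p \<noteq> 0" by (metis coeff_0 zero_neq_one)
  then have "card {a. poly ?p a = 0} \<le> degree ?p" by (rule card_poly_roots_bound)
  also have "\<dots> \<le> e" by (intro degree_diff_le degree_monom_le) simp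
  also have "e < card (UNIV - {0::'a})" using assms by (simp add: card_Diff_singleton)
  finally have "\<not> UNIV - {0::'a} \<subseteq> {a. poly ?p a = 0}"
    by (meson card_mono finite leD)
  then have "\<not> UNIV - {0::'a} \<subseteq> {a. a ^ e = 1}" by (simp add: poly_monom)
  then obtain b :: 'a where b: "b \<noteq> 0" "b ^ e \<noteq> 1" by auto
  have "(\<Sum>a\<in>UNIV. a ^ e) = (\<Sum>a\<in>UNIV. (a * b) ^ e)"
    by (rule sum.reindex_bij_witness[of _ "\<lambda>a. a * b" "\<lambda>a. a / b"]) (use b in auto)
  also have "\<dots> = b ^ e * (\<Sum>a\<in>UNIV. a ^ e)"
    by (simp add: power_mult_distrib sum_distrib_left mult.commute)
  finally have "(1 - b ^ e) * (\<Sum>a\<in>UNIV. a ^ e) = 0" by (simp add: algebra_simps)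
  with b show ?thesis by simp
qed

text \<open>As in the theorem of Chevalley and Warning: the degree is below
  \<open>k * (q - 1)\<close>, so each monomial has an exponent below q - 1, and its sum over F_q^k
  vanishes.\<close>

lemma sum_prod_affine_eq_0:
  fixes B :: "(nat \<Rightarrow> 'a::{finite,field}) set"
  assumes B: "finite B" "card B < k * (CARD('a) - 1)"
  shows "(\<Sum>w\<in>Fvecs k. \<Prod>b\<in>B. 1 + ip k w b) = 0"
proof -
  \<comment> \<open>The extra index \<open>k\<close> carries the constant term 1, so that each
    affine factor is a single sum over \<open>{..k}\<close> and the product expands over choice
    functions \<open>\<sigma>\<close>.\<close>
  define h where "h = (\<lambda>b j. if j < k then b j else 1 :: 'a)"
  define m where "m = (\<lambda>(w :: nat \<Rightarrow> 'a) j. if j < k then w j else 1)"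
  have affine: "1 + ip k w b = (\<Sum>j\<le>k. h b j * m w j)" for w b
    by (simp add: lessThan_Suc_atMost[symmetric] h_def m_def ip_def mult.commute)
  have monomial: "(\<Sum>w\<in>Fvecs k. \<Prod>b\<in>B. m w (\<sigma> b)) = 0" if \<sigma>: "\<sigma> \<in> B \<rightarrow>\<^sub>E {..k}" for \<sigma>
  proof -
    define e where "e = (\<lambda>j. card {b \<in> B. \<sigma> b = j})"
    have "(\<Prod>b\<in>B. m w (\<sigma> b)) = (\<Prod>j<k. w j ^ e j)" for w
    proof -
      have "(\<Prod>b\<in>B. m w (\<sigma> b)) = (\<Prod>j\<le>k. \<Prod>b\<in>{b \<in> B. \<sigma> b = j}. m w (\<sigma> b))"
        using B \<sigma> by (intro prod.group[symmetric]) auto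
      also have "\<dots> = (\<Prod>j\<le>k. m w j ^ e j)"
        by (intro prod.cong) (simp_all add: e_def)
      finally show ?thesis by (simp add: lessThan_Suc_atMost[symmetric] m_def)
    qed
    then have "(\<Sum>w\<in>Fvecs k. \<Prod>b\<in>B. m w (\<sigma> b)) = (\<Prod>j<k. \<Sum>a\<in>UNIV. a ^ e j)"
      by (simp add: prod_sum_Fvecs)
    \<comment> \<open>Otherwise the exponents below \<open>k\<close> would already exceed
      \<open>card B\<close>, the total number of factors.\<close>
    moreover have "\<exists>j<k. e j < CARD('a) - 1"
    proof (rule ccontr)
      assume "\<not> ?thesis"
      then have "(\<Sum>j<k. CARD('a) - 1) \<le> (\<Sum>j<k. e j)"
        by (intro sum_mono) (meson lessThan_iff not_less)
      also have "\<dots> \<le> (\<Sum>j\<le>k. e j)" by (intro sum_mono2) auto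
      also have "\<dots> = (\<Sum>j\<le>k. \<Sum>b\<in>{b \<in> B. \<sigma> b = j}. 1)" by (simp add: e_def)
      also have "\<dots> = card B"
        using B \<sigma> by (subst sum.group) auto
      finally show False using B by simp
    qed
    then obtain j where "j < k" "(\<Sum>a\<in>UNIV. (a::'a) ^ e j) = 0"
      using sum_field_power by blast
    ultimately show ?thesis by (auto intro: prod_zero)
  qed
  have "(\<Sum>w\<in>Fvecs k. \<Prod>b\<in>B. 1 + ip k w b) =
    (\<Sum>w\<in>Fvecs k. \<Sum>\<sigma>\<in>B \<rightarrow>\<^sub>E {..k}. (\<Prod>b\<in>B. h b (\<sigma> b)) * (\<Prod>b\<in>B. m w (\<sigma> b)))"
    unfolding affine using B by (simp add: prod_sum_PiE prod.distrib)
  also have "\<dots> = (\<Sum>\<sigma>\<in>B \<rightarrow>\<^sub>E {..k}. (\<Prod>b\<in>B. h b (\<sigma> b)) * (\<Sum>w\<in>Fvecs k. \<Prod>b\<in>B. m w (\<sigma> b)))"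
    by (subst sum.swap) (simp add: sum_distrib_left)
  finally show ?thesis by (simp add: monomial)
qed

text \<open>The theorem of Jamison and Brouwer--Schrijver on covering all points but the origin.\<close>

lemma affine_cover_card:
  fixes B :: "(nat \<Rightarrow> 'a::{finite,field}) set"
  assumes B: "finite B" and cover: "\<And>w. w \<in> Fvecs k \<Longrightarrow> w \<noteq> 0 \<Longrightarrow> \<exists>b\<in>B. 1 + ip k w b = 0"
  shows "k * (CARD('a) - 1) \<le> card B"
proof (rule ccontr)
  assume "\<not> ?thesis"
  then have "(\<Sum>w\<in>Fvecs k. \<Prod>b\<in>B. 1 + ip k w b) = 0"
    using B by (intro sum_prod_affine_eq_0) auto
  \<comment> \<open>The cover kills every term except that of the origin, which is 1.\<close>
  moreover have "(\<Sum>w\<in>Fvecs k. \<Prod>b\<in>B. 1 + ip k w b) = (\<Sum>w\<in>{0}. \<Prod>b\<in>B. 1 + ip k w b)"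
    using B cover by (intro sum.mono_neutral_right) (auto intro: prod_zero)
  ultimately show False by (simp add: ip_zero_left)
qed

section \<open>Points and hyperplanes as spans and kernels\<close>

interpretation vs: vector_space "scl :: 'a::field \<Rightarrow> _"
  by unfold_locales (auto simp: scl_def fun_eq_iff algebra_simps)

lemma subspace_ip_kernel: "vs.subspace {v \<in> Fvecs k. ip k z v = 0}"
  by (auto intro!: vs.subspaceI simp: ip_zero_right ip_add_right ip_scl_right)

lemma subspace_Fvecs: "vs.subspace (Fvecs k)"
  by (auto intro!: vs.subspaceI)

lemma span_uvec: "vs.span (uvec ` {..<k}) = (Fvecs k :: (nat \<Rightarrow> 'a::field) set)"
proof
  show "vs.span (uvec ` {..<k}) \<subseteq> Fvecs k"
    by (rule vs.span_minimal[OF _ subspace_Fvecs]) (auto simp: uvec_in_Fvecs)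
  show "Fvecs k \<subseteq> vs.span (uvec ` {..<k} :: (nat \<Rightarrow> 'a) set)"
  proof (induction k)
    case 0
    show ?case by (simp add: Fvecs_0)
  next
    case (Suc k)
    show ?case
    proof
      fix v :: "nat \<Rightarrow> 'a" assume v: "v \<in> Fvecs (Suc k)"
      then have "v(k := 0) \<in> Fvecs k" by (auto simp: Fvecs_def)
      then have 1: "v(k := 0) \<in> vs.span (uvec ` {..<k})" by (rule subsetD[OF Suc])
      have 2: "vs.span (uvec ` {..<k} :: (nat \<Rightarrow> 'a) set) \<subseteq> vs.span (uvec ` {..<Suc k})"
        by (intro vs.span_mono image_mono) auto
      have "v(k := 0) \<in> vs.span (uvec ` {..<Suc k})" by (rule subsetD[OF 2 1])
      moreover have "scl (v k) (uvec k) \<in> vs.span (uvec ` {..<Suc k})"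
        by (intro vs.span_scale vs.span_base) auto
      ultimately have "v(k := 0) + scl (v k) (uvec k) \<in> vs.span (uvec ` {..<Suc k})"
        by (rule vs.span_add)
      moreover have "v(k := 0) + scl (v k) (uvec k) = v"
        by (auto simp: fun_eq_iff scl_def uvec_def)
      ultimately show "v \<in> vs.span (uvec ` {..<Suc k})" by simp
    qed
  qed
qed

lemma independent_uvec: "vs.independent (uvec ` {..<k} :: (nat \<Rightarrow> 'a::field) set)"
proof (induction k)
  case 0
  show ?case by (simp add: vs.independent_empty)
next
  case (Suc k)
  have "uvec k \<notin> vs.span (uvec ` {..<k} :: (nat \<Rightarrow> 'a::field) set)"
    unfolding span_uvec by (auto simp: Fvecs_def uvec_def)
  with Suc show ?case by (simp add: lessThan_Suc vs.independent_insertI)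
qed

lemma dim_Fvecs: "vs.dim (Fvecs k :: (nat \<Rightarrow> 'a::field) set) = k"
proof (rule vs.dim_unique[of "uvec ` {..<k}"])
  show "card (uvec ` {..<k} :: (nat \<Rightarrow> 'a) set) = k"
    by (subst card_image) (auto simp: inj_on_def uvec_def fun_eq_iff split: if_splits)
qed (auto simp: uvec_in_Fvecs span_uvec independent_uvec)

text \<open>A unit vector \<open>uvec j\<close> with \<open>z j \<noteq> 0\<close> extends a basis
  of the kernel to one of \<open>Fvecs k\<close>.\<close>

lemma ip_kernel_hyperplane:
  fixes z :: "nat \<Rightarrow> 'a::{finite,field}"
  assumes z: "z \<in> Fvecs k" "z \<noteq> 0"
  shows "{v \<in> Fvecs k. ip k z v = 0} \<in> PG_hyperplanes k"
proof -
  let ?K = "{v \<in> Fvecs k. ip k z v = 0}"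
  obtain j where j: "j < k" "z j \<noteq> 0" using z by (rule Fvecs_nonzeroE)
  obtain B where B: "B \<subseteq> ?K" "vs.independent B" "?K \<subseteq> vs.span B" "card B = vs.dim ?K"
    by (rule vs.basis_exists)
  have span: "vs.span B = ?K"
    using B(1,3) subspace_ip_kernel by (rule vs.span_subspace)
  have finB: "finite B" using B(1) finite_Fvecs by (auto intro: finite_subset)
  have notin: "uvec j \<notin> vs.span B" unfolding span using j by (simp add: ip_uvec)
  have "vs.dim (Fvecs k :: (nat \<Rightarrow> 'a) set) = card (insert (uvec j) B)"
  proof (rule vs.dim_unique[of "insert (uvec j) B"])
    show "insert (uvec j) B \<subseteq> Fvecs k" using B(1) j by (auto simp: uvec_in_Fvecs)
    show "vs.independent (insert (uvec j) B)" using B(2) notin by (rule vs.independent_insertI[rotated])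
    show "Fvecs k \<subseteq> vs.span (insert (uvec j) B)"
    proof
      fix v :: "nat \<Rightarrow> 'a" assume v: "v \<in> Fvecs k"
      define c where "c = ip k z v / z j"
      have "v - scl c (uvec j) \<in> ?K"
        using v j by (auto simp: ip_diff_right ip_scl_right ip_uvec uvec_in_Fvecs c_def)
      then show "v \<in> vs.span (insert (uvec j) B)"
        unfolding span[symmetric] vs.span_breakdown_eq by blast
    qed
  qed simp
  moreover have "uvec j \<notin> B" using notin vs.span_base by blast
  ultimately have "vs.dim ?K = k - 1" using finB B(4) by (simp add: dim_Fvecs)
  then show ?thesis
    by (simp add: PG_hyperplanes_def subspaces_dim_def subspace_ip_kernel)
qed

lemma PG_pointE:
  fixes P :: "(nat \<Rightarrow> 'a::field) set"
  assumes "P \<in> PG_points k"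
  obtains g where "g \<in> Fvecs k" "P = vs.span {g}"
proof -
  from assms have P: "vs.subspace P" "P \<subseteq> Fvecs k" "vs.dim P = 1"
    by (auto simp: PG_points_def subspaces_dim_def)
  obtain B where B: "B \<subseteq> P" "vs.independent B" "P \<subseteq> vs.span B" "card B = vs.dim P"
    by (rule vs.basis_exists)
  then obtain g where g: "B = {g}" using P by (auto simp: card_1_singleton_iff)
  have "vs.span B = P" using B(1,3) P(1) by (rule vs.span_subspace)
  moreover have "g \<in> Fvecs k" using B(1) P(2) g by auto
  ultimately show thesis using that g by metis
qed

text \<open>The vectors \<open>scl (u j) (uvec i) - scl (u i) (uvec j)\<close> lie in the kernel of
  \<open>u\<close>; that \<open>z\<close> annihilates them makes the coordinates
  proportional.\<close>

lemma ip_kernel_subset_imp_multiple: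
  fixes u z :: "nat \<Rightarrow> 'a::field"
  assumes u: "u \<in> Fvecs k" "u \<noteq> 0" and z: "z \<in> Fvecs k"
    and sub: "{v \<in> Fvecs k. ip k u v = 0} \<subseteq> {v \<in> Fvecs k. ip k z v = 0}"
  obtains c where "z = scl c u"
proof -
  obtain j where j: "j < k" "u j \<noteq> 0" using u by (rule Fvecs_nonzeroE)
  have "z = scl (z j / u j) u"
  proof
    fix i
    show "z i = scl (z j / u j) u i"
    proof (cases "i < k")
      case True
      have "scl (u j) (uvec i) - scl (u i) (uvec j) \<in> {v \<in> Fvecs k. ip k u v = 0}"
        using True j by (auto simp: ip_diff_right ip_scl_right ip_uvec uvec_in_Fvecs)
      then have "ip k z (scl (u j) (uvec i) - scl (u i) (uvec j)) = 0"
        using sub by blast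
      then have "u j * z i = u i * z j"
        using True j by (simp add: ip_diff_right ip_scl_right ip_uvec)
      with j show ?thesis by (simp add: scl_def field_simps)
    next
      case False
      with u z show ?thesis by (simp add: Fvecs_def scl_def)
    qed
  qed
  then show thesis by (rule that)
qed

text \<open>If all points of \<open>S\<close> in the kernel of \<open>u\<close> lay in that of
  \<open>z\<close>, so would their span, which is the whole kernel of \<open>u\<close>. The vector
  \<open>rep P\<close> later serves as a column of the generator matrix.\<close>

lemma strong_blocking_set_point:
  fixes z u :: "nat \<Rightarrow> 'a::{finite,field}"
  assumes S: "strong_blocking_set k S"
    and z: "z \<in> Fvecs k" and u: "u \<in> Fvecs k" "u \<noteq> 0" and nm: "\<And>c. z \<noteq> scl c u"
    and rep: "\<And>P. P \<in> S \<Longrightarrow> rep P \<in> Fvecs k \<and> P = vs.span {rep P}"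
  shows "\<exists>P\<in>S. ip k u (rep P) = 0 \<and> ip k z (rep P) \<noteq> 0"
proof (rule ccontr)
  assume neg: "\<not> ?thesis"
  let ?H = "{v \<in> Fvecs k. ip k u v = 0}" and ?Z = "{v \<in> Fvecs k. ip k z v = 0}"
  have "P \<subseteq> ?Z" if "P \<in> S" "P \<subseteq> ?H" for P
  proof -
    have "rep P \<in> P" using rep[OF that(1)] vs.span_base[of "rep P" "{rep P}"] by auto
    then have "rep P \<in> ?Z" using that neg rep by auto
    then have "vs.span {rep P} \<subseteq> ?Z" by (intro vs.span_minimal subspace_ip_kernel) auto
    then show ?thesis using rep[OF that(1)] by simp
  qed
  then have "vs.span (\<Union>{P \<in> S. P \<subseteq> ?H}) \<subseteq> ?Z"
    by (intro vs.span_minimal subspace_ip_kernel Union_least) simp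
  moreover have "\<forall>H\<in>PG_hyperplanes k. vs.span (\<Union>{P \<in> S. P \<subseteq> H}) = H"
    using S by (simp add: strong_blocking_set_def)
  then have "vs.span (\<Union>{P \<in> S. P \<subseteq> ?H}) = ?H"
    using ip_kernel_hyperplane[OF u] by (rule bspec)
  ultimately have "?H \<subseteq> ?Z" by simp
  then obtain c where "z = scl c u"
    by (rule ip_kernel_subset_imp_multiple[OF u z])
  with nm show False by blast
qed

lemma finite_PG_points: "finite (PG_points k :: (nat \<Rightarrow> 'a::{finite,field}) set set)"
proof (rule finite_subset)
  show "PG_points k \<subseteq> Pow (Fvecs k :: (nat \<Rightarrow> 'a) set)"
    by (auto simp: PG_points_def subspaces_dim_def)
qed simp

text \<open>Outside the hyperplane of \<open>z\<close>, the points of \<open>S\<close> block every affine hyperplane, and they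
  are turned into a cover of the dual space minus its origin. The dual vectors \<open>w\<close> that do not
  vanish at the chosen point \<open>P0\<close> are covered by the \<open>q - 1\<close> multiples of \<open>h P0\<close>.\<close>

lemma strong_blocking_set_weight:
  fixes z :: "nat \<Rightarrow> 'a::{finite,field}"
  assumes S: "strong_blocking_set k S" and k: "2 \<le> k" and z: "z \<in> Fvecs k" "z \<noteq> 0"
    and rep: "\<And>P. P \<in> S \<Longrightarrow> rep P \<in> Fvecs k \<and> P = vs.span {rep P}"
  shows "(k - 1) * (CARD('a) - 1) < card {P \<in> S. ip k z (rep P) \<noteq> 0}"
proof -
  define T where "T = {P \<in> S. ip k z (rep P) \<noteq> 0}"
  have finT: "finite T"
    using S finite_PG_points unfolding T_def strong_blocking_set_def by (auto intro: finite_subset)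
  note point = strong_blocking_set_point[OF S z(1) _ _ _ rep]
  obtain j where j: "j < k" "z j \<noteq> 0" using z by (rule Fvecs_nonzeroE)
  \<comment> \<open>Since \<open>z j \<noteq> 0\<close>, \<open>z\<close> is no multiple of a unit
    vector with another index; this makes \<open>T\<close> nonempty.\<close>
  obtain i where i: "i < k" "i \<noteq> j"
    using k that[of "if j = 0 then 1 else 0"] by (auto split: if_splits)
  have "z \<noteq> scl c (uvec i)" for c
    using i j by (auto simp: uvec_def scl_def fun_eq_iff intro!: exI[of _ j])
  then obtain P0 where P0: "P0 \<in> T"
    using point[OF uvec_in_Fvecs[OF i(1)] uvec_nonzero] unfolding T_def by blast
  \<comment> \<open>With \<open>ip k z (h P) = 1\<close> one has
    \<open>1 + ip k w (h P) = ip k (z + w) (h P)\<close>, so covering \<open>w\<close> means finding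
    a point of \<open>T\<close> in the kernel of \<open>z + w\<close>.\<close>
  define h where "h = (\<lambda>P. scl (1 / ip k z (rep P)) (rep P))"
  have zh: "ip k z (h P) = 1" if "P \<in> T" for P
    using that by (simp add: h_def T_def ip_scl_right)
  \<comment> \<open>Trading \<open>P0\<close> for its q - 1 multiples gives at most
    \<open>card T - 1 + (q - 1)\<close> vectors; the lost one makes the final inequality
    strict.\<close>
  define B where "B = h ` (T - {P0}) \<union> (\<lambda>c. scl c (h P0)) ` (UNIV - {0})"
  have "k * (CARD('a) - 1) \<le> card B"
  proof (rule affine_cover_card)
    show "finite B" using finT by (simp add: B_def)
    fix w :: "nat \<Rightarrow> 'a" assume w: "w \<in> Fvecs k" "w \<noteq> 0"
    show "\<exists>b\<in>B. 1 + ip k w b = 0"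
    proof (cases "ip k w (h P0) = 0")
      case False
      then show ?thesis
        by (intro bexI[of _ "scl (inverse (- ip k w (h P0))) (h P0)"], subst ip_scl_right, simp)
          (unfold B_def, intro UnI2 imageI, simp)
    next
      case True
      \<comment> \<open>Both \<open>z\<close> and \<open>z + w\<close> take the value 1 at
        \<open>h P0\<close>. So \<open>z\<close> could only be 1 times \<open>z + w\<close>,
        contrary to \<open>w \<noteq> 0\<close>, and the blocking point found is not
        \<open>P0\<close>.\<close>
      have uh: "ip k (z + w) (h P0) = 1" using True zh[OF P0] by (simp add: ip_add_left)
      then have "z + w \<noteq> 0" by (auto simp: ip_zero_left)
      moreover have "z \<noteq> scl c (z + w)" for c
      proof
        assume eq: "z = scl c (z + w)"
        have "ip k z (h P0) = ip k (scl c (z + w)) (h P0)" using eq by simp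
        then have "c = 1" using uh zh[OF P0] by (simp add: ip_scl_left)
        with eq have "z = z + w" by (simp only: vs.scale_one)
        with w show False using add_cancel_right_right[of z w] by blast
      qed
      ultimately obtain P where P: "P \<in> S" "ip k (z + w) (rep P) = 0" "ip k z (rep P) \<noteq> 0"
        using point[of "z + w"] z w by blast
      then have "ip k (z + w) (h P) = 0" "P \<in> T" by (auto simp: h_def ip_scl_right T_def)
      moreover from this uh have "P \<noteq> P0" by auto
      ultimately show ?thesis
        using zh by (intro bexI[of _ "h P"]) (auto simp: B_def ip_add_left)
    qed
  qed
  also have "card B \<le> card (h ` (T - {P0})) + card ((\<lambda>c. scl c (h P0)) ` (UNIV - {0}))"
    unfolding B_def by (rule card_Un_le)
  also have "\<dots> \<le> card (T - {P0}) + card (UNIV - {0::'a})"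
    using finT by (intro add_mono card_image_le) auto
  also have "\<dots> = card T - 1 + (CARD('a) - 1)"
    using finT P0 by (simp add: card_Diff_singleton)
  finally have "k * (CARD('a) - 1) \<le> card T - 1 + (CARD('a) - 1)" .
  moreover have "0 < card T" using finT P0 by (auto simp: card_gt_0_iff)
  moreover have "(k - 1) * (CARD('a) - 1) + (CARD('a) - 1) = k * (CARD('a) - 1)"
    using k by (cases k) auto
  ultimately show ?thesis unfolding T_def[symmetric] by linarith
qed

section \<open>The asymptotic MRRW bound\<close>

text \<open>The argument of the entropy in \<open>Mq\<close> has a name of its own because it is the
  relative radius of the ball in the covering argument.\<close>

definition mrrw_radius :: "real \<Rightarrow> real \<Rightarrow> real" where
  "mrrw_radius q \<delta> = (q - 1 - (q - 2) * \<delta> - 2 * sqrt ((q - 1) * \<delta> * (1 - \<delta>))) / q"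

lemma Mq_eq: "Mq q \<delta> = Hq q (mrrw_radius q \<delta>)"
  by (simp add: Mq_def mrrw_radius_def)

text \<open>Completing the square. The first form gives sign and monotonicity of the radius; both
  together evaluate the root in \<open>sphere_eigenvalue_mrrw_radius\<close>.\<close>

lemma mrrw_radius_square:
  assumes "2 \<le> q" "0 \<le> \<delta>" "\<delta> \<le> 1"
  shows "mrrw_radius q \<delta> = (sqrt ((q - 1) * (1 - \<delta>)) - sqrt \<delta>)\<^sup>2 / q"
    and "1 - mrrw_radius q \<delta> = (sqrt (1 - \<delta>) + sqrt ((q - 1) * \<delta>))\<^sup>2 / q"
proof -
  have s: "sqrt ((q - 1) * \<delta> * (1 - \<delta>)) = sqrt (q - 1) * sqrt \<delta> * sqrt (1 - \<delta>)"
    by (simp add: real_sqrt_mult)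
  have "(sqrt ((q - 1) * (1 - \<delta>)) - sqrt \<delta>)\<^sup>2 =
      (q - 1) * (1 - \<delta>) + \<delta> - 2 * (sqrt (q - 1) * sqrt \<delta> * sqrt (1 - \<delta>))"
    using assms by (simp add: power2_diff real_sqrt_mult power_mult_distrib mult_ac)
  also have "\<dots> = q - 1 - (q - 2) * \<delta> - 2 * (sqrt (q - 1) * sqrt \<delta> * sqrt (1 - \<delta>))"
    by (simp add: algebra_simps)
  finally show "mrrw_radius q \<delta> = (sqrt ((q - 1) * (1 - \<delta>)) - sqrt \<delta>)\<^sup>2 / q"
    unfolding mrrw_radius_def s by simp
  have "(sqrt (1 - \<delta>) + sqrt ((q - 1) * \<delta>))\<^sup>2 =
      (1 - \<delta>) + (q - 1) * \<delta> + 2 * (sqrt (q - 1) * sqrt \<delta> * sqrt (1 - \<delta>))"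
    using assms by (simp add: power2_sum real_sqrt_mult power_mult_distrib mult_ac)
  also have "\<dots> = 1 + (q - 2) * \<delta> + 2 * (sqrt (q - 1) * sqrt \<delta> * sqrt (1 - \<delta>))"
    by (simp add: algebra_simps)
  finally have "(sqrt (1 - \<delta>) + sqrt ((q - 1) * \<delta>))\<^sup>2 =
      1 + (q - 2) * \<delta> + 2 * (sqrt (q - 1) * sqrt \<delta> * sqrt (1 - \<delta>))" .
  moreover have "1 - mrrw_radius q \<delta> = (1 + (q - 2) * \<delta> + 2 * (sqrt (q - 1) * sqrt \<delta> * sqrt (1 - \<delta>))) / q"
    using assms unfolding mrrw_radius_def s by (simp add: field_simps)
  ultimately show "1 - mrrw_radius q \<delta> = (sqrt (1 - \<delta>) + sqrt ((q - 1) * \<delta>))\<^sup>2 / q"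
    by simp
qed

lemma sqrt_diff_nonneg:
  fixes q :: real
  assumes "2 \<le> q" "\<delta> \<le> (q - 1) / q"
  shows "0 \<le> sqrt ((q - 1) * (1 - \<delta>)) - sqrt \<delta>"
proof -
  have "\<delta> \<le> (q - 1) * (1 - \<delta>)" using assms by (simp add: field_simps)
  then show ?thesis by simp
qed

text \<open>With \<open>\<delta> = sin\<^sup>2\<close> of an angle, \<open>mrrw_radius\<close> becomes a reflection of that angle, so it is an
  involution; this is why the eigenvalue of a ball of relative radius \<open>mrrw_radius q \<delta>\<close> is
  the one belonging to relative weight \<open>\<delta>\<close>.\<close>

lemma sphere_eigenvalue_mrrw_radius:
  assumes q: "2 \<le> q" and \<delta>: "0 \<le> \<delta>" "\<delta> \<le> (q - 1) / q"
  shows "(q - 2) * mrrw_radius q \<delta> + 2 * sqrt ((q - 1) * mrrw_radius q \<delta> * (1 - mrrw_radius q \<delta>)) = q - 1 - q * \<delta>"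
proof -
  define a b p where "a = sqrt (1 - \<delta>)" and "b = sqrt \<delta>" and "p = sqrt (q - 1)"
  have "(q - 1) / q \<le> 1" using q by simp
  with \<delta> have \<delta>1: "\<delta> \<le> 1" by linarith
  have sq: "a\<^sup>2 = 1 - \<delta>" "b\<^sup>2 = \<delta>" "p\<^sup>2 = q - 1"
    using q \<delta> \<delta>1 by (simp_all add: a_def b_def p_def)
  have nn: "0 \<le> a" "0 \<le> b" "0 \<le> p" using q \<delta> \<delta>1 by (simp_all add: a_def b_def p_def)
  have pab: "0 \<le> p * a - b"
    using sqrt_diff_nonneg[OF q \<delta>(2)] by (simp add: a_def b_def p_def real_sqrt_mult)
  have r: "mrrw_radius q \<delta> = (p * a - b)\<^sup>2 / q" "1 - mrrw_radius q \<delta> = (a + p * b)\<^sup>2 / q"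
    using mrrw_radius_square[OF q \<delta>(1) \<delta>1] by (simp_all add: a_def b_def p_def real_sqrt_mult)
  have "(q - 1) * mrrw_radius q \<delta> * (1 - mrrw_radius q \<delta>) = (p * (p * a - b) * (a + p * b) / q)\<^sup>2"
    unfolding r(2) unfolding r(1) sq(3)[symmetric] by (simp add: power2_eq_square)
  then have s: "sqrt ((q - 1) * mrrw_radius q \<delta> * (1 - mrrw_radius q \<delta>)) = p * (p * a - b) * (a + p * b) / q"
    using q nn pab by simp
  have "q * ((q - 2) * mrrw_radius q \<delta> + 2 * sqrt ((q - 1) * mrrw_radius q \<delta> * (1 - mrrw_radius q \<delta>))) =
      (q - 2) * (p * a - b)\<^sup>2 + 2 * (p * (p * a - b) * (a + p * b))"
    unfolding s unfolding r(1) using q by (simp add: field_simps)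
  also have "\<dots> = (p\<^sup>2 - 1) * (p * a - b)\<^sup>2 + 2 * (p * (p * a - b) * (a + p * b))"
    using sq by simp
  also have "\<dots> = (p\<^sup>2 + 1) * (p\<^sup>2 * a\<^sup>2 - b\<^sup>2)"
    by (simp add: power2_eq_square algebra_simps)
  also have "\<dots> = q * (q - 1 - q * \<delta>)"
    unfolding sq by (simp add: algebra_simps)
  finally show ?thesis using q by simp
qed

lemma mrrw_radius_strict_antimono:
  assumes q: "2 \<le> q" and "0 \<le> \<delta>" "\<delta> < \<delta>'" "\<delta>' \<le> (q - 1) / q"
  shows "mrrw_radius q \<delta>' < mrrw_radius q \<delta>"
proof -
  have "(q - 1) / q \<le> 1" using q by simp
  with assms have b: "\<delta> \<le> 1" "\<delta>' \<le> 1" "0 \<le> \<delta>'" by linarith+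
  have "(q - 1) * (1 - \<delta>') \<le> (q - 1) * (1 - \<delta>)" using assms by (intro mult_left_mono) auto
  then have "sqrt ((q - 1) * (1 - \<delta>')) \<le> sqrt ((q - 1) * (1 - \<delta>))" by simp
  moreover have "sqrt \<delta> < sqrt \<delta>'" using assms by simp
  ultimately have "sqrt ((q - 1) * (1 - \<delta>')) - sqrt \<delta>' < sqrt ((q - 1) * (1 - \<delta>)) - sqrt \<delta>"
    by linarith
  then have "(sqrt ((q - 1) * (1 - \<delta>')) - sqrt \<delta>')\<^sup>2 < (sqrt ((q - 1) * (1 - \<delta>)) - sqrt \<delta>)\<^sup>2"
    using sqrt_diff_nonneg[OF q assms(4)] by (intro power_strict_mono) auto
  then show ?thesis
    unfolding mrrw_radius_square(1)[OF q assms(2) b(1)] mrrw_radius_square(1)[OF q b(3) b(2)]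
    using q by (intro divide_strict_right_mono) auto
qed

lemma mrrw_radius_0: "0 < q \<Longrightarrow> mrrw_radius q 0 = (q - 1) / q"
  by (simp add: mrrw_radius_def)

lemma mrrw_radius_bounds:
  assumes q: "2 \<le> q" and \<delta>: "0 \<le> \<delta>" "\<delta> < (q - 1) / q"
  shows "0 < mrrw_radius q \<delta>" "mrrw_radius q \<delta> \<le> (q - 1) / q" "mrrw_radius q \<delta> < 1"
proof -
  have "0 \<le> mrrw_radius q ((q - 1) / q)"
    using q by (subst mrrw_radius_square) auto
  also have "\<dots> < mrrw_radius q \<delta>"
    using \<delta> by (intro mrrw_radius_strict_antimono[OF q]) auto
  finally show "0 < mrrw_radius q \<delta>" .
  show le: "mrrw_radius q \<delta> \<le> (q - 1) / q"
    using mrrw_radius_strict_antimono[OF q, of 0 \<delta>] mrrw_radius_0[of q] q \<delta>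
    by (cases "\<delta> = 0") auto
  have "(q - 1) / q < 1" using q by simp
  with le show "mrrw_radius q \<delta> < 1" by linarith
qed

section \<open>Continuity and monotonicity of the entropy and of \<open>Mq\<close>\<close>

lemma continuous_on_Hq:
  assumes "1 < q"
  shows "continuous_on {0<..<1} (Hq q)"
  unfolding Hq_def log_def using assms by (auto intro!: continuous_intros)

text \<open>The interval is open on the right because the radius vanishes at
  \<open>(q - 1) / q\<close>, an endpoint of the range where \<open>Hq\<close> is shown
  continuous.\<close>

lemma continuous_on_Mq:
  assumes q: "2 \<le> q"
  shows "continuous_on {0..<(q - 1) / q} (Mq q)"
proof -
  have "continuous_on {0..<(q - 1) / q} (\<lambda>\<delta>. Hq q (mrrw_radius q \<delta>))"
  proof (rule continuous_on_compose2[of "{0<..<1}" "Hq q" _ "mrrw_radius q"])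
    show "continuous_on {0<..<1} (Hq q)" using q by (intro continuous_on_Hq) simp
    show "continuous_on {0..<(q - 1) / q} (mrrw_radius q)"
      unfolding mrrw_radius_def using q by (auto intro!: continuous_intros)
    show "mrrw_radius q ` {0..<(q - 1) / q} \<subseteq> {0<..<1}"
      using mrrw_radius_bounds[OF q] by auto
  qed
  then show ?thesis by (simp add: Mq_eq)
qed

text \<open>The derivative is \<open>ln ((q - 1) * (1 - z) / z) / ln q\<close>, positive exactly
  while \<open>z < (q - 1) / q\<close>.\<close>

lemma Hq_strict_mono:
  assumes q: "2 \<le> q" and x: "0 < x" "x < y" "y \<le> (q - 1) / q"
  shows "Hq q x < Hq q y"
proof (rule DERIV_pos_imp_increasing_open[OF x(2)])
  have y1: "(q - 1) / q < 1" using q by simp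
  have "y < 1" using x y1 by linarith
  then show "continuous_on {x..y} (Hq q)"
    using q x by (intro continuous_on_subset[OF continuous_on_Hq]) auto
  fix z assume z: "x < z" "z < y"
  then have z': "0 < z" "z < 1" "z < (q - 1) / q" using x y1 by linarith+
  have "z < (q - 1) * (1 - z)" using z' q by (simp add: field_simps)
  then have "ln z < ln ((q - 1) * (1 - z))" using z' q by (subst ln_less_cancel_iff) auto
  then have pos: "0 < ln (q - 1) - ln z + ln (1 - z)" using z' q by (simp add: ln_mult)
  have "((\<lambda>x. x * ln (q - 1) - x * ln x - (1 - x) * ln (1 - x)) has_real_derivative
      ln (q - 1) - ln z + ln (1 - z)) (at z)"
    using z' by (auto intro!: derivative_eq_intros)
  then have "((\<lambda>x. (x * ln (q - 1) - x * ln x - (1 - x) * ln (1 - x)) / ln q) has_real_derivative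
      (ln (q - 1) - ln z + ln (1 - z)) / ln q) (at z)"
    by (rule DERIV_cdivide)
  moreover have "Hq q = (\<lambda>x. (x * ln (q - 1) - x * ln x - (1 - x) * ln (1 - x)) / ln q)"
    by (simp add: Hq_def log_def fun_eq_iff diff_divide_distrib)
  ultimately have "(Hq q has_real_derivative (ln (q - 1) - ln z + ln (1 - z)) / ln q) (at z)"
    by simp
  moreover have "0 < (ln (q - 1) - ln z + ln (1 - z)) / ln q" using pos q by simp
  ultimately show "\<exists>D. (Hq q has_real_derivative D) (at z) \<and> 0 < D" by blast
qed

lemma Mq_strict_antimono:
  assumes q: "2 \<le> q" and "0 \<le> \<delta>" "\<delta> < \<delta>'" "\<delta>' < (q - 1) / q"
  shows "Mq q \<delta>' < Mq q \<delta>"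
  unfolding Mq_eq using assms
  by (intro Hq_strict_mono mrrw_radius_strict_antimono mrrw_radius_bounds) auto

lemma Mq_0:
  assumes "2 \<le> q"
  shows "Mq q 0 = 1"
proof -
  have "1 - (q - 1) / q = 1 / q" using assms by (simp add: field_simps)
  then have "Mq q 0 = (q - 1) / q * log q (q - 1) - (q - 1) / q * log q ((q - 1) / q) - 1 / q * log q (1 / q)"
    using assms by (simp add: Mq_eq mrrw_radius_0 Hq_def)
  also have "log q ((q - 1) / q) = log q (q - 1) - 1" using assms by (simp add: log_divide)
  also have "log q (1 / q) = - 1" using assms by (simp add: log_divide)
  finally show ?thesis using assms by (simp add: field_simps)
qed

section \<open>The entropy bound for Hamming balls\<close>

text \<open>This \<open>t\<close> minimises \<open>(1 + (q - 1) * t) / t powr \<rho>\<close>, and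
  the minimum is \<open>q powr Hq q \<rho>\<close>. Replacing \<open>\<rho> * real n\<close> by
  \<open>r\<close> is allowed because \<open>ln t \<le> 0\<close>.\<close>

lemma ball_generating_function_le_entropy:
  assumes q: "2 \<le> q" and \<rho>: "0 < \<rho>" "\<rho> \<le> (q - 1) / q" and r: "real r \<le> \<rho> * real n"
  defines "t \<equiv> \<rho> / ((1 - \<rho>) * (q - 1))"
  shows "0 < t" "t \<le> 1" "(1 + (q - 1) * t) ^ n \<le> t ^ r * q powr (real n * Hq q \<rho>)"
proof -
  have "(q - 1) / q < 1" using q by simp
  then have \<rho>1: "\<rho> < 1" using \<rho> by linarith
  show t: "0 < t" using q \<rho> \<rho>1 by (simp add: t_def)
  have "\<rho> \<le> (1 - \<rho>) * (q - 1)" using \<rho> q by (simp add: field_simps)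
  then show t1: "t \<le> 1" using q \<rho>1 by (simp add: t_def divide_le_eq)
  have lt: "ln t = ln \<rho> - ln (1 - \<rho>) - ln (q - 1)"
    using q \<rho> \<rho>1 by (simp add: t_def ln_div ln_mult)
  have "(q - 1) * t = \<rho> / (1 - \<rho>)" using q by (simp add: t_def)
  then have base: "1 + (q - 1) * t = 1 / (1 - \<rho>)" using \<rho>1 by (simp add: field_simps)
  have H: "Hq q \<rho> * ln q = \<rho> * ln (q - 1) - \<rho> * ln \<rho> - (1 - \<rho>) * ln (1 - \<rho>)"
    using q unfolding Hq_def log_def by (simp add: field_simps)
  have "(1 + (q - 1) * t) ^ n = exp (real n * ln (1 / (1 - \<rho>)))"
    unfolding base using \<rho>1 by (simp add: exp_of_nat_mult)
  also have "ln (1 / (1 - \<rho>)) = \<rho> * ln t + Hq q \<rho> * ln q"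
    using \<rho>1 unfolding H lt by (simp add: ln_div algebra_simps)
  also have "exp (real n * (\<rho> * ln t + Hq q \<rho> * ln q)) \<le> exp (real r * ln t + real n * Hq q \<rho> * ln q)"
  proof -
    have "(\<rho> * real n) * ln t \<le> real r * ln t"
      using r t t1 by (intro mult_right_mono_neg) auto
    then show ?thesis by (simp add: algebra_simps)
  qed
  also have "\<dots> = t ^ r * q powr (real n * Hq q \<rho>)"
    using q t by (simp add: exp_add exp_of_nat_mult powr_def)
  finally show "(1 + (q - 1) * t) ^ n \<le> t ^ r * q powr (real n * Hq q \<rho>)" .
qed

lemma card_ball_le_entropy:
  fixes \<rho> :: real
  defines "q \<equiv> real CARD('a::{finite,field})"
  assumes "0 < \<rho>" "\<rho> \<le> (q - 1) / q" "real r \<le> \<rho> * real n"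
  shows "real (card {x \<in> (Fvecs n :: (nat \<Rightarrow> 'a) set). wt n x \<le> r}) \<le> q powr (real n * Hq q \<rho>)"
proof -
  have q: "2 \<le> q" using CARD_ge_2[where 'a = 'a] by (simp add: q_def)
  define t where "t = \<rho> / ((1 - \<rho>) * (q - 1))"
  note t = ball_generating_function_le_entropy[OF q assms(2-), folded t_def]
  have "real (card {x \<in> (Fvecs n :: (nat \<Rightarrow> 'a) set). wt n x \<le> r}) * t ^ r \<le> (1 + (q - 1) * t) ^ n"
    unfolding q_def by (rule card_ball_le[OF t(1,2)])
  also note t(3)
  finally show ?thesis using t(1) by (simp add: mult.commute)
qed

section \<open>Passage to large length\<close>

lemma tendsto_nat_floor_over:
  fixes \<rho> :: real
  assumes "0 \<le> \<rho>"
  shows "(\<lambda>n. real (nat \<lfloor>\<rho> * real n\<rfloor>) / real n) \<longlonglongrightarrow> \<rho>"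
proof (rule tendsto_sandwich[of "\<lambda>n. \<rho> - 1 / real n" _ _ "\<lambda>n. \<rho>"])
  show "\<forall>\<^sub>F n in sequentially. \<rho> - 1 / real n \<le> real (nat \<lfloor>\<rho> * real n\<rfloor>) / real n"
    using eventually_gt_at_top[of 0]
  proof eventually_elim
    case (elim n)
    have "\<rho> * real n - 1 \<le> real (nat \<lfloor>\<rho> * real n\<rfloor>)" by linarith
    then have "(\<rho> * real n - 1) / real n \<le> real (nat \<lfloor>\<rho> * real n\<rfloor>) / real n"
      by (rule divide_right_mono) simp
    then show ?case using elim by (simp add: diff_divide_distrib)
  qed
  show "\<forall>\<^sub>F n in sequentially. real (nat \<lfloor>\<rho> * real n\<rfloor>) / real n \<le> \<rho>"
    using eventually_gt_at_top[of 0]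
  proof eventually_elim
    case (elim n)
    have "real (nat \<lfloor>\<rho> * real n\<rfloor>) \<le> \<rho> * real n" using assms by simp
    then show ?case using elim by (simp add: field_simps)
  qed
  have "(\<lambda>n. \<rho> - 1 / real n) \<longlonglongrightarrow> \<rho> - 0"
    by (intro tendsto_diff tendsto_const lim_const_over_n)
  then show "(\<lambda>n. \<rho> - 1 / real n) \<longlonglongrightarrow> \<rho>" by simp
qed simp

text \<open>First \<open>m\<close> is fixed so large that the cosine is near 1; then
  \<open>n\<close> grows and the window, of bounded length, is negligible after division by
  \<open>n\<close>. The window ends at the floor of \<open>\<rho> * real n\<close>, which is thus
  the radius of the ball.\<close>

lemma eventually_eigenvalue_ge:
  fixes q \<rho> :: real
  assumes q: "2 \<le> q" and \<rho>: "0 < \<rho>" "\<rho> < 1"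
    and l: "l < (q - 2) * \<rho> + 2 * sqrt ((q - 1) * \<rho> * (1 - \<rho>))"
  obtains m where "1 \<le> m" "\<forall>\<^sub>F n in sequentially. m < nat \<lfloor>\<rho> * real n\<rfloor> \<and> nat \<lfloor>\<rho> * real n\<rfloor> < n \<and>
    l * real n \<le> real (nat \<lfloor>\<rho> * real n\<rfloor> - m) * (q - 2) + 2 * cos (pi / (real m + 1)) *
      sqrt (real (nat \<lfloor>\<rho> * real n\<rfloor> - m) * ((real n - real (nat \<lfloor>\<rho> * real n\<rfloor>)) * (q - 1)))"
proof -
  have "(\<lambda>m. pi * inverse (real (Suc m))) \<longlonglongrightarrow> pi * 0"
    by (intro tendsto_mult tendsto_const LIMSEQ_inverse_real_of_nat)
  then have "(\<lambda>m. pi / (real m + 1)) \<longlonglongrightarrow> 0" by (simp add: divide_inverse add.commute)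
  then have "(\<lambda>m. (q - 2) * \<rho> + 2 * cos (pi / (real m + 1)) * sqrt ((q - 1) * \<rho> * (1 - \<rho>)))
      \<longlonglongrightarrow> (q - 2) * \<rho> + 2 * cos 0 * sqrt ((q - 1) * \<rho> * (1 - \<rho>))"
    by (intro tendsto_intros)
  then have "\<forall>\<^sub>F m in sequentially. l < (q - 2) * \<rho> + 2 * cos (pi / (real m + 1)) * sqrt ((q - 1) * \<rho> * (1 - \<rho>))"
    using l by (intro order_tendstoD) auto
  then have "\<forall>\<^sub>F m in sequentially. 1 \<le> m \<and>
      l < (q - 2) * \<rho> + 2 * cos (pi / (real m + 1)) * sqrt ((q - 1) * \<rho> * (1 - \<rho>))"
    using eventually_ge_at_top[of 1] by eventually_elim simp
  then obtain m where m: "1 \<le> m"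
      "l < (q - 2) * \<rho> + 2 * cos (pi / (real m + 1)) * sqrt ((q - 1) * \<rho> * (1 - \<rho>))"
    using eventually_happens by force
  define r where "r = (\<lambda>n. nat \<lfloor>\<rho> * real n\<rfloor>)"
  have rlim: "(\<lambda>n. real (r n) / real n) \<longlonglongrightarrow> \<rho>"
    unfolding r_def using \<rho> by (intro tendsto_nat_floor_over) simp
  have mlim: "(\<lambda>n. real m / real n) \<longlonglongrightarrow> 0" by (rule lim_const_over_n)
  have "(\<lambda>n. (real (r n) / real n - real m / real n) * (q - 2) + 2 * cos (pi / (real m + 1)) *
      sqrt ((real (r n) / real n - real m / real n) * ((1 - real (r n) / real n) * (q - 1))))
    \<longlonglongrightarrow> (\<rho> - 0) * (q - 2) + 2 * cos (pi / (real m + 1)) * sqrt ((\<rho> - 0) * ((1 - \<rho>) * (q - 1)))"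
    by (intro tendsto_intros rlim mlim)
  then have ev1: "\<forall>\<^sub>F n in sequentially. l < (real (r n) / real n - real m / real n) * (q - 2) + 2 * cos (pi / (real m + 1)) *
      sqrt ((real (r n) / real n - real m / real n) * ((1 - real (r n) / real n) * (q - 1)))"
    by (rule order_tendstoD) (use m(2) in \<open>simp add: mult_ac\<close>)
  have "(\<lambda>n. real (r n) / real n - real m / real n) \<longlonglongrightarrow> \<rho> - 0"
    by (intro tendsto_intros rlim mlim)
  then have ev2: "\<forall>\<^sub>F n in sequentially. 0 < real (r n) / real n - real m / real n"
    by (rule order_tendstoD) (use \<rho> in simp)
  have ev3: "\<forall>\<^sub>F n in sequentially. real (r n) / real n < 1"
    using rlim by (rule order_tendstoD) (use \<rho> in simp)
  have "\<forall>\<^sub>F n in sequentially. m < r n \<and> r n < n \<and>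
    l * real n \<le> real (r n - m) * (q - 2) + 2 * cos (pi / (real m + 1)) *
      sqrt (real (r n - m) * ((real n - real (r n)) * (q - 1)))"
    using ev1 ev2 ev3 eventually_gt_at_top[of 0]
  proof eventually_elim
    case (elim n)
    have n: "0 < real n" using elim by simp
    have "0 < (real (r n) - real m) / real n" using elim(2) by (simp add: diff_divide_distrib)
    then have mr: "m < r n" using n by (simp add: zero_less_divide_iff)
    have rn: "r n < n" using elim(3) n by simp
    have e: "real (r n) / real n - real m / real n = real (r n - m) / real n"
      using mr by (simp add: of_nat_diff diff_divide_distrib)
    have e': "1 - real (r n) / real n = (real n - real (r n)) / real n"
      using n by (simp add: field_simps)
    have "sqrt (real (r n - m) / real n * ((real n - real (r n)) / real n * (q - 1))) =
        sqrt (real (r n - m) * ((real n - real (r n)) * (q - 1)) / (real n)\<^sup>2)"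
      by (simp add: power2_eq_square)
    also have "\<dots> = sqrt (real (r n - m) * ((real n - real (r n)) * (q - 1))) / real n"
      by (subst real_sqrt_divide) simp
    finally have "l < real (r n - m) / real n * (q - 2) + 2 * cos (pi / (real m + 1)) *
        (sqrt (real (r n - m) * ((real n - real (r n)) * (q - 1))) / real n)"
      using elim(1) unfolding e e' by simp
    also have "\<dots> = (real (r n - m) * (q - 2) + 2 * cos (pi / (real m + 1)) *
        sqrt (real (r n - m) * ((real n - real (r n)) * (q - 1)))) / real n"
      by (simp add: add_divide_distrib)
    finally show ?case using mr rn n by (simp add: field_simps)
  qed
  then show thesis using that m(1) unfolding r_def by blast
qed

text \<open>At \<open>\<delta>'\<close> slightly below \<open>\<delta>\<close> the ball has an
  eigenvalue exceeding the nontrivial spectrum by a margin linear in \<open>n\<close>, so its size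
  is at least a constant times \<open>q ^ k\<close>. Half of \<open>\<epsilon>\<close> pays for this
  constant, half for the change of \<open>Mq\<close> between \<open>\<delta>'\<close> and
  \<open>\<delta>\<close>.\<close>

lemma mrrw_bound:
  fixes \<delta> \<epsilon> :: real
  defines "q \<equiv> real CARD('a::{finite,field})"
  assumes \<delta>: "0 < \<delta>" "\<delta> < (q - 1) / q" and \<epsilon>: "0 < \<epsilon>"
  obtains N where "\<And>n k d (g :: nat \<Rightarrow> nat \<Rightarrow> 'a). \<lbrakk>N \<le> n; 1 \<le> k; \<And>i. i < n \<Longrightarrow> g i \<in> Fvecs k;
      \<And>z. z \<in> Fvecs k \<Longrightarrow> z \<noteq> 0 \<Longrightarrow> d \<le> card {i. i < n \<and> ip k z (g i) \<noteq> 0}; \<delta> * real n \<le> real d\<rbrakk>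
    \<Longrightarrow> real k \<le> (Mq q \<delta> + \<epsilon>) * real n"
proof -
  have q: "2 \<le> q" using CARD_ge_2[where 'a = 'a] by (simp add: q_def)
  have "continuous_on {0<..<(q - 1) / q} (Mq q)"
    by (rule continuous_on_subset[OF continuous_on_Mq[OF q]]) auto
  then have "isCont (Mq q) \<delta>"
    using \<delta> by (simp add: continuous_on_eq_continuous_at)
  then have "(Mq q \<longlongrightarrow> Mq q \<delta>) (at_left \<delta>)"
    by (simp add: isCont_def filterlim_at_split)
  then have "\<forall>\<^sub>F \<delta>' in at_left \<delta>. Mq q \<delta>' < Mq q \<delta> + \<epsilon> / 2"
    using \<epsilon> by (intro order_tendstoD) auto
  moreover have "\<forall>\<^sub>F \<delta>' in at_left \<delta>. \<delta>' \<in> {0<..<\<delta>}"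
    using \<delta> by (intro eventually_at_left_field[THEN iffD2]) auto
  ultimately have "\<forall>\<^sub>F \<delta>' in at_left \<delta>. Mq q \<delta>' < Mq q \<delta> + \<epsilon> / 2 \<and> \<delta>' \<in> {0<..<\<delta>}"
    by eventually_elim simp
  then obtain \<delta>' where \<delta>': "Mq q \<delta>' < Mq q \<delta> + \<epsilon> / 2" "0 < \<delta>'" "\<delta>' < \<delta>"
    using eventually_happens[of _ "at_left \<delta>"] by (auto simp: trivial_limit_at_left_real)
  define \<rho> where "\<rho> = mrrw_radius q \<delta>'"
  have \<rho>: "0 < \<rho>" "\<rho> \<le> (q - 1) / q" "\<rho> < 1"
    unfolding \<rho>_def using mrrw_radius_bounds[OF q] \<delta> \<delta>' by auto
  \<comment> \<open>Only half of the available surplus is claimed, which leaves the strict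
    inequality needed for the limit.\<close>
  define \<eta> where "\<eta> = q * (\<delta> - \<delta>') / 2"
  have \<eta>: "0 < \<eta>" using q \<delta>' by (simp add: \<eta>_def)
  have "q - 1 - q * \<delta> + \<eta> < q - 1 - q * \<delta>'"
    using \<eta> by (simp add: \<eta>_def field_simps)
  also have "\<dots> = (q - 2) * \<rho> + 2 * sqrt ((q - 1) * \<rho> * (1 - \<rho>))"
    unfolding \<rho>_def using \<delta> \<delta>' q by (intro sphere_eigenvalue_mrrw_radius[symmetric]) auto
  finally obtain m where m: "1 \<le> m" and ev: "\<forall>\<^sub>F n in sequentially.
    m < nat \<lfloor>\<rho> * real n\<rfloor> \<and> nat \<lfloor>\<rho> * real n\<rfloor> < n \<and> (q - 1 - q * \<delta> + \<eta>) * real n \<le>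
      real (nat \<lfloor>\<rho> * real n\<rfloor> - m) * (q - 2) + 2 * cos (pi / (real m + 1)) *
      sqrt (real (nat \<lfloor>\<rho> * real n\<rfloor> - m) * ((real n - real (nat \<lfloor>\<rho> * real n\<rfloor>)) * (q - 1)))"
    using eventually_eigenvalue_ge[OF q \<rho>(1,3)] by blast
  have "\<forall>\<^sub>F n in sequentially. 2 / \<epsilon> * log q (q / \<eta>) \<le> real n"
    using filterlim_real_sequentially by (simp add: filterlim_at_top)
  from eventually_conj[OF ev this] obtain N where N: "\<forall>n\<ge>N. (m < nat \<lfloor>\<rho> * real n\<rfloor> \<and>
      nat \<lfloor>\<rho> * real n\<rfloor> < n \<and> (q - 1 - q * \<delta> + \<eta>) * real n \<le>
      real (nat \<lfloor>\<rho> * real n\<rfloor> - m) * (q - 2) + 2 * cos (pi / (real m + 1)) *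
      sqrt (real (nat \<lfloor>\<rho> * real n\<rfloor> - m) * ((real n - real (nat \<lfloor>\<rho> * real n\<rfloor>)) * (q - 1)))) \<and>
      2 / \<epsilon> * log q (q / \<eta>) \<le> real n"
    unfolding eventually_sequentially by blast
  show thesis
  proof (rule that)
    fix n k d and g :: "nat \<Rightarrow> nat \<Rightarrow> 'a"
    assume n: "N \<le> n" and k: "1 \<le> k" and g: "\<And>i. i < n \<Longrightarrow> g i \<in> Fvecs k"
      and d: "\<And>z. z \<in> Fvecs k \<Longrightarrow> z \<noteq> 0 \<Longrightarrow> d \<le> card {i. i < n \<and> ip k z (g i) \<noteq> 0}"
      and dn: "\<delta> * real n \<le> real d"
    define r where "r = nat \<lfloor>\<rho> * real n\<rfloor>"
    note N1 = N[rule_format, OF n, THEN conjunct1, folded r_def]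
    have rm: "r - m + m = r" and npos: "0 < real n" using N1 by auto
    \<comment> \<open>As \<open>k \<ge> 1\<close>, there is a nonzero message, and its weight bounds
      \<open>d\<close> by \<open>n\<close>.\<close>
    have "d \<le> card {i. i < n \<and> ip k (uvec 0) (g i) \<noteq> 0}"
      by (rule d[OF uvec_in_Fvecs uvec_nonzero]) (use k in simp)
    also have "\<dots> \<le> card {..<n}" by (rule card_mono) auto
    finally have dn': "d \<le> n" by simp
    have "\<eta> * real n * q ^ k \<le> q * real d * real (card {x \<in> (Fvecs n :: (nat \<Rightarrow> 'a) set). wt n x \<le> r - m + m})"
      unfolding q_def
    proof (rule linear_code_size_le_ball[OF g d])
      have "(q - 1) * real n - q * real d + \<eta> * real n \<le> (q - 1 - q * \<delta> + \<eta>) * real n"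
        using mult_left_mono[OF dn, of q] q by (simp add: algebra_simps)
      also note N1[THEN conjunct2, THEN conjunct2]
      finally show "(real CARD('a) - 1) * real n - real CARD('a) * real d + \<eta> * real n \<le>
        real (r - m) * (real CARD('a) - 2) + 2 * cos (pi / (real m + 1)) *
        sqrt (real (r - m) * ((real n - real (r - m + m)) * (real CARD('a) - 1)))"
        unfolding rm q_def .
    qed (use N1 m in auto)
    also have "\<dots> \<le> q * real n * q powr (real n * Hq q \<rho>)"
      unfolding rm
    proof (intro mult_mono)
      show "real (card {x \<in> (Fvecs n :: (nat \<Rightarrow> 'a) set). wt n x \<le> r}) \<le> q powr (real n * Hq q \<rho>)"
        using \<rho> unfolding q_def by (intro card_ball_le_entropy) (auto simp: r_def)
    qed (use q dn' in auto)
    finally have "real n * (\<eta> * q ^ k) \<le> real n * (q * q powr (real n * Hq q \<rho>))"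
      by (simp add: mult_ac)
    then have "\<eta> * q ^ k \<le> q * q powr (real n * Hq q \<rho>)" using npos by simp
    then have "q powr real k \<le> q / \<eta> * q powr (real n * Hq q \<rho>)"
      using \<eta> q by (simp add: powr_realpow field_simps)
    also have "\<dots> = q powr (log q (q / \<eta>) + real n * Hq q \<rho>)"
      using \<eta> q by (simp add: powr_add)
    finally have "real k \<le> log q (q / \<eta>) + real n * Hq q \<rho>" using q by simp
    also have "log q (q / \<eta>) \<le> \<epsilon> / 2 * real n"
      using N[rule_format, OF n, THEN conjunct2] \<epsilon> by (simp add: field_simps)
    also have "real n * Hq q \<rho> \<le> real n * (Mq q \<delta> + \<epsilon> / 2)"
      using \<delta>'(1) unfolding Mq_eq \<rho>_def by (intro mult_left_mono) auto
    finally show "real k \<le> (Mq q \<delta> + \<epsilon>) * real n" by (simp add: algebra_simps)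
  qed
qed

section \<open>The constant\<close>

lemma mrrw_radius_at_max:
  assumes q: "2 \<le> q"
  shows "mrrw_radius q ((q - 1) / (q + 1)) = (q - 1) * (3 - 2 * sqrt 2) / (q * (q + 1))"
proof -
  have "1 - (q - 1) / (q + 1) = 2 / (q + 1)" using q by (simp add: field_simps)
  then have "(q - 1) * ((q - 1) / (q + 1)) * (1 - (q - 1) / (q + 1)) = ((q - 1) / (q + 1))\<^sup>2 * 2"
    by (simp add: power2_eq_square)
  then have "sqrt ((q - 1) * ((q - 1) / (q + 1)) * (1 - (q - 1) / (q + 1))) = (q - 1) / (q + 1) * sqrt 2"
    using q by (simp add: real_sqrt_mult)
  then show ?thesis using q unfolding mrrw_radius_def by (simp add: field_simps)
qed

text \<open>This strict inequality is the source of \<open>c > 1\<close>. Elementary bounds on the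
  logarithms give \<open>(q + 1) * Hq q y \<le> 5.4 * \<kappa>\<close>, and
  \<open>\<kappa> < 0.172\<close> makes this less than 1.\<close>

lemma Mq_at_max_less:
  assumes q: "2 \<le> q"
  shows "Mq q ((q - 1) / (q + 1)) < 1 / (q + 1)"
proof -
  define \<kappa> :: real where "\<kappa> = 3 - 2 * sqrt 2"
  define y where "y = mrrw_radius q ((q - 1) / (q + 1))"
  have "1.414 < sqrt 2" by (rule real_less_rsqrt) (simp add: power2_eq_square)
  moreover have "sqrt 2 < 1.4143" by (rule real_less_lsqrt) (simp_all add: power2_eq_square)
  ultimately have \<kappa>: "1 / 6 < \<kappa>" "\<kappa> < 0.172" by (simp_all add: \<kappa>_def)
  have y: "y = (q - 1) * \<kappa> / (q * (q + 1))"
    unfolding y_def \<kappa>_def by (rule mrrw_radius_at_max[OF q])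
  have "(q - 1) / (q + 1) < (q - 1) / q"
    using q by (intro divide_strict_left_mono) auto
  then have y01: "0 < y" "y < 1"
    unfolding y_def using mrrw_radius_bounds[OF q, of "(q - 1) / (q + 1)"] q by auto
  have "- ln (1 - y) \<le> y / (1 - y)"
    using ln_le_minus_one[of "1 / (1 - y)"] y01 by (simp add: ln_div field_simps)
  then have ln1: "- (1 - y) * ln (1 - y) \<le> y"
    using y01 by (simp add: field_simps)
  have lnq: "(q - 1) / q \<le> ln q"
    using ln_le_minus_one[of "1 / q"] q by (simp add: ln_div field_simps)
  have "(q - 1) / y = q * (q + 1) / \<kappa>" using q \<kappa> by (simp add: y)
  also have "\<dots> \<le> q * (q + 1) * 6"
  proof -
    have "1 / \<kappa> \<le> 6" using \<kappa> by (simp add: field_simps)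
    from mult_left_mono[OF this, of "q * (q + 1)"] q show ?thesis by simp
  qed
  also have "\<dots> \<le> 9 * (q * q)" using q by (simp add: algebra_simps)
  finally have "ln ((q - 1) / y) \<le> ln (9 * (q * q))"
    using q y01 by (intro ln_mono) auto
  also have "\<dots> = ln 9 + 2 * ln q" using q by (simp add: ln_mult)
  finally have "ln (q - 1) - ln y \<le> ln 9 + 2 * ln q" using q y01 by (simp add: ln_div)
  moreover have "ln 9 \<le> (2.4 :: real)"
  proof -
    \<comment> \<open>The base is 1.78, a lower bound for \<open>exp 0.6\<close>, and its fourth
      power is about 10.04.\<close>
    have "(9 :: real) \<le> (1 + 0.6 + 0.6\<^sup>2 / 2) ^ 4" by (simp add: power_numeral_reduce)
    also have "\<dots> \<le> exp 0.6 ^ 4" by (intro power_mono exp_lower_Taylor_quadratic) auto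
    also have "\<dots> = exp 2.4" by (simp flip: exp_of_nat_mult)
    finally have "ln 9 \<le> ln (exp (2.4 :: real))" by (subst ln_le_cancel_iff) auto
    then show ?thesis by simp
  qed
  ultimately have le: "1 + ln (q - 1) - ln y \<le> 3.4 + 2 * ln q" by simp
  have "Hq q y * ln q = y * ln (q - 1) - y * ln y - (1 - y) * ln (1 - y)"
    using q unfolding Hq_def log_def by (simp add: field_simps)
  also have "\<dots> \<le> y * (1 + ln (q - 1) - ln y)" using ln1 by (simp add: algebra_simps)
  also have "\<dots> \<le> y * (3.4 + 2 * ln q)" using le y01 by (intro mult_left_mono) auto
  finally have "(q + 1) * (Hq q y * ln q) \<le> (q + 1) * (y * (3.4 + 2 * ln q))"
    using q by (intro mult_left_mono) auto
  also have "\<dots> = \<kappa> * (3.4 * ((q - 1) / q) + 2 * ((q - 1) / q) * ln q)"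
  proof -
    have "(q + 1) * y = \<kappa> * ((q - 1) / q)" unfolding y using q by simp
    then have "(q + 1) * (y * (3.4 + 2 * ln q)) = \<kappa> * ((q - 1) / q) * (3.4 + 2 * ln q)"
      by (simp only: mult.assoc[symmetric])
    then show ?thesis by (simp add: distrib_left mult_ac)
  qed
  \<comment> \<open>The factor \<open>(q - 1) / q\<close> is replaced by \<open>ln q\<close> in the
    first term and by 1 in the second, so that \<open>ln q\<close> can be cancelled.\<close>
  also have "\<dots> \<le> \<kappa> * (3.4 * ln q + 2 * 1 * ln q)"
    using \<kappa> lnq q by (intro mult_left_mono add_mono mult_right_mono) auto
  also have "\<dots> = (5.4 * \<kappa>) * ln q" by (simp add: algebra_simps)
  also have "\<dots> < 1 * ln q" using \<kappa> q by (intro mult_strict_right_mono) auto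
  finally have "((q + 1) * Hq q y) * ln q < 1 * ln q" by (simp add: mult_ac)
  then have "(q + 1) * Hq q y < 1" using q by (simp add: mult_less_cancel_right)
  then show ?thesis using q by (simp add: Mq_eq y_def field_simps)
qed

text \<open>The variable is \<open>s = 1 / x\<close>, so that the range \<open>x \<ge> 1\<close> becomes a compact interval.\<close>

definition rate_gap :: "real \<Rightarrow> real \<Rightarrow> real" where
  "rate_gap q s = Mq q ((q - 1) * s / (q + 1)) - s / (q + 1)"

lemma rate_gap_arg:
  fixes q s :: real
  assumes "2 \<le> q" "0 \<le> s" "s \<le> 1"
  shows "0 \<le> (q - 1) * s / (q + 1)" "(q - 1) * s / (q + 1) < (q - 1) / q"
proof -
  show "0 \<le> (q - 1) * s / (q + 1)" using assms by simp
  have "(q - 1) * s / (q + 1) \<le> (q - 1) * 1 / (q + 1)"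
    using assms by (intro divide_right_mono mult_left_mono) auto
  also have "\<dots> < (q - 1) / q" using assms by (simp add: field_simps)
  finally show "(q - 1) * s / (q + 1) < (q - 1) / q" .
qed

lemma rate_gap_strict_antimono:
  assumes q: "2 \<le> q" and "0 \<le> s" "s < s'" "s' \<le> 1"
  shows "rate_gap q s' < rate_gap q s"
proof -
  have "Mq q ((q - 1) * s' / (q + 1)) < Mq q ((q - 1) * s / (q + 1))"
    using assms rate_gap_arg[of q]
    by (intro Mq_strict_antimono[OF q]) (auto intro!: divide_strict_right_mono)
  moreover have "s / (q + 1) < s' / (q + 1)"
    using assms by (intro divide_strict_right_mono) auto
  ultimately show ?thesis by (simp add: rate_gap_def)
qed

text \<open>The gap is 1 at \<open>s = 0\<close> and negative at \<open>s = 1\<close>, so the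
  intermediate value theorem applies.\<close>

lemma rate_gap_root:
  assumes q: "2 \<le> q"
  obtains s where "0 < s" "s < 1" "rate_gap q s = 0"
proof -
  have "continuous_on {0..1} (\<lambda>s. Mq q ((q - 1) * s / (q + 1)))"
    using q rate_gap_arg[OF q]
    by (intro continuous_on_compose2[OF continuous_on_Mq[OF q]] continuous_intros) auto
  then have "continuous_on {0..1} (rate_gap q)"
    unfolding rate_gap_def using q by (intro continuous_intros) auto
  moreover have "rate_gap q 0 = 1" by (simp add: rate_gap_def Mq_0[OF q])
  moreover have "rate_gap q 1 < 0" using Mq_at_max_less[OF q] by (simp add: rate_gap_def)
  ultimately obtain s where "0 \<le> s" "s \<le> 1" "rate_gap q s = 0"
    using IVT2'[of "rate_gap q" 1 0 0] by auto
  moreover from this have "s \<noteq> 0" "s \<noteq> 1"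
    using \<open>rate_gap q 0 = 1\<close> \<open>rate_gap q 1 < 0\<close> by auto
  ultimately show thesis using that[of s] by simp
qed

lemma rate_equation_iff:
  "Mq q ((q - 1) / (x * (q + 1))) = 1 / (x * (q + 1)) \<longleftrightarrow> rate_gap q (1 / x) = 0"
  by (simp add: rate_gap_def)

lemma rate_equation_solution_gt_1:
  assumes q: "2 \<le> q" and x: "1 \<le> x" "rate_gap q (1 / x) = 0"
  shows "1 < x"
proof (rule ccontr)
  assume "\<not> 1 < x"
  then have "x = 1" using x by simp
  then show False using x Mq_at_max_less[OF q] by (simp add: rate_gap_def)
qed

lemma ex1_rate_equation:
  assumes q: "2 \<le> q"
  shows "\<exists>!x. 1 \<le> x \<and> rate_gap q (1 / x) = 0"
proof -
  obtain s where s: "0 < s" "s < 1" "rate_gap q s = 0" by (rule rate_gap_root[OF q])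
  show ?thesis
  proof (rule ex1I)
    show "1 \<le> 1 / s \<and> rate_gap q (1 / (1 / s)) = 0" using s by simp
    fix x assume x: "1 \<le> x \<and> rate_gap q (1 / x) = 0"
    then have "1 / x = s"
      using rate_gap_strict_antimono[OF q, of s "1 / x"] rate_gap_strict_antimono[OF q, of "1 / x" s] s
      by (cases "1 / x" s rule: linorder_cases) auto
    then show "x = 1 / s" using x by auto
  qed
qed

section \<open>From codes to strong blocking sets\<close>

text \<open>With \<open>- rate_gap q (1 / x)\<close> as the error term, the MRRW bound reads
  \<open>k \<le> n / (x * (q + 1))\<close>. A smaller \<open>S\<close>, padded to length
  \<open>n \<le> x * (q + 1) * (k - 1)\<close>, would then give
  \<open>k \<le> k - 1\<close>.\<close>

lemma strong_blocking_set_card_ge: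
  fixes x :: real
  defines "q \<equiv> real CARD('a::{finite,field})"
  assumes x: "1 \<le> x" and gap: "rate_gap q (1 / x) < 0"
  shows "\<exists>K. \<forall>k\<ge>K. \<forall>S :: (nat \<Rightarrow> 'a) set set.
    strong_blocking_set k S \<longrightarrow> x * (q + 1) * (real k - 1) \<le> real (card S)"
proof -
  have q: "2 \<le> q" using CARD_ge_2[where 'a = 'a] by (simp add: q_def)
  define \<delta> where "\<delta> = (q - 1) * (1 / x) / (q + 1)"
  have \<delta>: "0 < \<delta>" "\<delta> < (q - 1) / q"
    using q x rate_gap_arg(2)[OF q, of "1 / x"] by (simp_all add: \<delta>_def)
  obtain N where N: "\<And>n k d (g :: nat \<Rightarrow> nat \<Rightarrow> 'a). \<lbrakk>N \<le> n; 1 \<le> k; \<And>i. i < n \<Longrightarrow> g i \<in> Fvecs k;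
      \<And>z. z \<in> Fvecs k \<Longrightarrow> z \<noteq> 0 \<Longrightarrow> d \<le> card {i. i < n \<and> ip k z (g i) \<noteq> 0}; \<delta> * real n \<le> real d\<rbrakk>
    \<Longrightarrow> real k \<le> (Mq q \<delta> + - rate_gap q (1 / x)) * real n"
    using mrrw_bound[where 'a = 'a, of \<delta> "- rate_gap q (1 / x)"] \<delta> gap unfolding q_def by auto
  \<comment> \<open>The threshold \<open>N + 2\<close> ensures both \<open>N \<le> n\<close>, as
    \<open>x * (q + 1) \<ge> 1\<close>, and the dimension at least 2 required by
    \<open>strong_blocking_set_weight\<close>.\<close>
  have "x * (q + 1) * (real k - 1) \<le> real (card S)"
    if k: "N + 2 \<le> k" and S: "strong_blocking_set k S" for k and S :: "(nat \<Rightarrow> 'a) set set"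
  proof (rule ccontr)
    assume less: "\<not> ?thesis"
    define n where "n = nat \<lfloor>x * (q + 1) * (real k - 1)\<rfloor>"
    have "0 \<le> x * (q + 1) * (real k - 1)" using x q k by simp
    then have n: "real n \<le> x * (q + 1) * (real k - 1)" unfolding n_def by (rule of_nat_floor)
    have Sn: "card S \<le> n" using less unfolding n_def by (intro le_nat_floor) simp
    have "1 * 1 \<le> x * (q + 1)" using x q by (intro mult_mono) auto
    then have "1 * (real k - 1) \<le> x * (q + 1) * (real k - 1)"
      using k by (intro mult_right_mono) auto
    moreover have "real N \<le> 1 * (real k - 1)" using k by simp
    ultimately have "N \<le> n" unfolding n_def by (intro le_nat_floor) (rule order_trans)
    have "S \<subseteq> PG_points k" using S by (simp add: strong_blocking_set_def)
    then have "\<forall>P\<in>S. \<exists>g. g \<in> Fvecs k \<and> P = vs.span {g}" by (meson PG_pointE subsetD)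
    then obtain rep where rep: "\<And>P. P \<in> S \<Longrightarrow> rep P \<in> Fvecs k \<and> P = vs.span {rep P}"
      by (metis (no_types, lifting))
    have "finite S" using \<open>S \<subseteq> PG_points k\<close> finite_PG_points by (rule finite_subset)
    then obtain f where f: "bij_betw f {..<card S} S"
      using ex_bij_betw_nat_finite atLeast0LessThan by metis
    \<comment> \<open>Zero columns lengthen the code without changing any weight.\<close>
    define g where "g = (\<lambda>i. if i < card S then rep (f i) else 0)"
    have fS: "f i \<in> S" if "i < card S" for i
      using f that by (auto simp: bij_betw_def)
    have "real k \<le> (Mq q \<delta> + - rate_gap q (1 / x)) * real n"
    proof (rule N[OF \<open>N \<le> n\<close>])
      show "1 \<le> k" using k by simp
      show "g i \<in> Fvecs k" for i using rep fS by (simp add: g_def)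
      have "\<delta> * real n \<le> \<delta> * (x * (q + 1) * (real k - 1))"
        using n \<delta> by (intro mult_left_mono) auto
      also have "\<dots> = (q - 1) * (real k - 1)" using x q by (simp add: \<delta>_def)
      also have "\<dots> = real ((k - 1) * (CARD('a) - 1))"
        using k CARD_ge_2[where 'a = 'a] by (simp add: q_def of_nat_diff)
      finally show "\<delta> * real n \<le> real ((k - 1) * (CARD('a) - 1))" .
      fix z :: "nat \<Rightarrow> 'a" assume z: "z \<in> Fvecs k" "z \<noteq> 0"
      have "(k - 1) * (CARD('a) - 1) < card {P \<in> S. ip k z (rep P) \<noteq> 0}"
        using k by (intro strong_blocking_set_weight[OF S _ z rep]) auto
      also have "\<dots> \<le> card (f ` {i. i < n \<and> ip k z (g i) \<noteq> 0})"
      proof (rule card_mono)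
        show "{P \<in> S. ip k z (rep P) \<noteq> 0} \<subseteq> f ` {i. i < n \<and> ip k z (g i) \<noteq> 0}"
        proof
          fix P assume P: "P \<in> {P \<in> S. ip k z (rep P) \<noteq> 0}"
          then obtain i where "i < card S" "P = f i" using f by (auto simp: bij_betw_def)
          then show "P \<in> f ` {i. i < n \<and> ip k z (g i) \<noteq> 0}"
            using P Sn by (intro image_eqI[of _ _ i]) (auto simp: g_def)
        qed
      qed simp
      also have "\<dots> \<le> card {i. i < n \<and> ip k z (g i) \<noteq> 0}" by (rule card_image_le) simp
      finally show "(k - 1) * (CARD('a) - 1) \<le> card {i. i < n \<and> ip k z (g i) \<noteq> 0}" by simp
    qed
    also have "\<dots> = 1 / (x * (q + 1)) * real n" by (simp add: rate_gap_def \<delta>_def)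
    also have "\<dots> \<le> 1 / (x * (q + 1)) * (x * (q + 1) * (real k - 1))"
      using n x q by (intro mult_left_mono) auto
    also have "\<dots> = real k - 1" using x q by simp
    finally show False by simp
  qed
  then show ?thesis by blast
qed

theorem theorem1p4:
  fixes q :: real
  assumes "q = real (card (UNIV :: 'a::{finite,field} set))"
  shows "(\<exists>!x. x \<ge> 1 \<and> Mq q ((q - 1) / (x * (q + 1))) = 1 / (x * (q + 1))) \<and>
         (\<forall>c. c \<ge> 1 \<and> Mq q ((q - 1) / (c * (q + 1))) = 1 / (c * (q + 1)) \<longrightarrow>
              c > 1 \<and>
              (\<forall>\<epsilon>>0. \<exists>K. \<forall>k\<ge>K. \<forall>S :: (nat \<Rightarrow> 'a) set set.
                  strong_blocking_set k S \<longrightarrow> real (card S) \<ge> (c - \<epsilon>) * (q + 1) * (real k - 1)))"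
  unfolding rate_equation_iff
proof (intro conjI allI impI)
  have q: "2 \<le> q" using CARD_ge_2[where 'a = 'a] assms by simp
  show "\<exists>!x. 1 \<le> x \<and> rate_gap q (1 / x) = 0" by (rule ex1_rate_equation[OF q])
  fix c :: real assume c: "1 \<le> c \<and> rate_gap q (1 / c) = 0"
  then show c1: "1 < c" using rate_equation_solution_gt_1[OF q] by blast
  fix \<epsilon> :: real assume \<epsilon>: "0 < \<epsilon>"
  \<comment> \<open>Taking the maximum with 1 keeps \<open>1 / x\<close> in the range where the gap
    is monotone; for large \<open>\<epsilon>\<close> the bound for \<open>x = 1\<close> is the
    stronger one.\<close>
  define x where "x = max 1 (c - \<epsilon>)"
  have x: "1 \<le> x" "x < c" "c - \<epsilon> \<le> x" using c1 \<epsilon> by (auto simp: x_def)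
  have "rate_gap q (1 / x) < rate_gap q (1 / c)"
    using x by (intro rate_gap_strict_antimono[OF q]) (auto simp: divide_strict_left_mono)
  then obtain K where K: "\<forall>k\<ge>K. \<forall>S :: (nat \<Rightarrow> 'a) set set.
      strong_blocking_set k S \<longrightarrow> x * (q + 1) * (real k - 1) \<le> real (card S)"
    using strong_blocking_set_card_ge[where 'a = 'a, OF x(1)] c assms by auto
  show "\<exists>K. \<forall>k\<ge>K. \<forall>S :: (nat \<Rightarrow> 'a) set set.
      strong_blocking_set k S \<longrightarrow> (c - \<epsilon>) * (q + 1) * (real k - 1) \<le> real (card S)"
  \<comment> \<open>Requiring \<open>k \<ge> 1\<close> makes \<open>real k - 1\<close> nonnegative,
    so that \<open>c - \<epsilon>\<close> may be replaced by the larger \<open>x\<close>.\<close>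
  proof (intro exI[of _ "max 1 K"] allI impI)
    fix k and S :: "(nat \<Rightarrow> 'a) set set" assume k: "max 1 K \<le> k" and S: "strong_blocking_set k S"
    have "(c - \<epsilon>) * (q + 1) * (real k - 1) \<le> x * (q + 1) * (real k - 1)"
      using x(3) q k by (intro mult_right_mono) auto
    also have "\<dots> \<le> real (card S)" using K S k by simp
    finally show "(c - \<epsilon>) * (q + 1) * (real k - 1) \<le> real (card S)" .
  qed
qed

end
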